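(* Consider the interconnection of the line dynamics $$ \begin{aligned} [\mathcal{L}\otimes I_2]\,\dot I^{\mathcal N}_{DQ} &= -[\mathcal{R}\otimes I_2+\omega_s\mathcal{L}\otimes J]\,I^{\mathcal N}_{DQ}+[H_C^T\otimes I_2]\,V^C_{DQ}+[H_B^T\otimes I_2]\,V_{DQ},\\ [\mathcal{C}\otimes I_2]\,\dot V^C_{DQ} &= -[\mathcal{G}\otimes I_2+\omega_s\mathcal{C}\otimes J]\,V^C_{DQ}-[H_C\otimes I_2]\,I^{\mathcal N}_{DQ},\\ I_{DQ} &= [H_B\otimes I_2]\,I^{\mathcal N}_{DQ}, \end{aligned} $$ with the bus dynamics, for each bus $j\in N$, $$\dot x_j=f_j(x_j,w_j),\qquad z_j=g_j(x_j,w_j),\qquad w_j=-i^j_{DQ},\quad v^j_{DQ}=z_j,$$ where $V_{DQ}=[v^j_{DQ}]_{j\in N}$, $I_{DQ}=[i^j_{DQ}]_{j\in N}$, each $f_j$ is locally Lipschitz and each $g_j$ is continuous. Suppose there exists an equilibrium $q^*=(I^{\mathcal N*}_{DQ},V^{C*}_{DQ},x_1^*,\dots,x_{|N|}^* )$ of this interconnected system such that, with $w_j^*=-i^{j*}_{DQ}$ the corresponding equilibrium bus inputs, for every bus $j\in N$: (i) the bus dynamics are locally output-strictly passive about $(w_j^*,x_j^* )$, with a storage function $\mathcal{V}_j(x_j)$ that is continuous and has a strict local minimum at $x_j^*$; and (ii) for the constant input $w_j\equiv w_j^*$, the equilibrium $x_j^*$ of the bus dynamics is locally asymptotically stable. Then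 the equilibrium $q^*$ of the interconnected system is asymptotically stable.
   Context: Network. $N=\{1,\dots,|N|\}$ is the set of buses of a power network. Each line is an RLC ladder with an arbitrary finite number of series R-L subsections, with parallel G-C elements at the internal junctions between consecutive subsections; parameters may vary along the line. Let $(N_L,E_L)$ be the directed graph (directions arbitrary) whose nodes are the buses (the first $|N|$ nodes) followed by the internal capacitor nodes of all lines (indexed by $N_C$), and whose edges are all R-L subsections of all lines. Its incidence matrix $H\in\mathbb{R}^{|N_L|\times|E_L|}$ has $H_{iz}=1$ if edge $z$ leaves node $i$, $H_{iz}=-1$ if edge $z$ enters node $i$, and $H_{iz}=0$ otherwise. $H_B$ consists of the first $|N|$ rows of $H$ and $H_C$ of the last $|N_C|$ rows. $\mathcal{R},\mathcal{L}$ (size $|E_L|\times|E_L|$) and $\mathcal{G},\mathcal{C}$ (size $|N_C|\times|N_C|$) are diagonal matrices with positive diagonal entries. $\omega_s$ is a real constant, $J=\begin{bmatrix}0&1\\-1&0\end{bmatrix}$, $I_2$ is the $2\times 2$ identity, $\otimes$ is the Kronecker product. $v^j_{DQ},i^j_{DQ}\in\mathbb{R}^2$ are the voltage of bus $j$ and the total current injected by bus $j$ into the network, $I^{\mathcal N}_{DQ}\in\mathbb{R}^{2|E_L|}$ is the vector of edge currents, $V^C_{DQ}\in\mathbb{R}^{2|N_C|}$ the vector of internal capacitor voltages. The states $x_j$ are finite-dimensional and $w_j,z_j\in\mathbb{R}^2$. A superscript $*$ denotes an equilibrium value. Output-strict passivity. A system $\dot x_j=f_j(x_j,w_j)$, $z_j=g_j(x_j,w_j)$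 is locally output-strictly passive about an equilibrium $(w_j^*,x_j^* )$ (with $z_j^*=g_j(x_j^*,w_j^* )$) if there are open neighbourhoods $W_j$ of $w_j^*$ and $X_j$ of $x_j^*$, a continuously differentiable positive semi-definite function $\mathcal{V}_j(x_j)$ (the storage function), and a positive definite $\phi_j$ (i.e. $y^T\phi_j(y)>0$ for $y\ne0$) such that for all $w_j\in W_j$, $x_j\in X_j$: $\dot{\mathcal V}_j\le (w_j-w_j^* )^T(z_j-z_j^* )-(z_j-z_j^* )^T\phi_j(z_j-z_j^* )$, where $\dot{\mathcal V}_j=\nabla\mathcal V_j(x_j)^Tf_j(x_j,w_j)$. *)

theory Defs
  imports "HOL-Analysis.Analysis"
begin

text \<open>
  HOL types are never empty and a type cannot depend on a term, so index sets that may be empty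
  (internal nodes, edges) and state spaces whose dimension varies from bus to bus are represented
  inside larger types: edges and internal nodes are subsets \<open>E\<close>, \<open>NC\<close> of finite types, and the state
  space of bus \<open>j\<close> is a linear subspace \<open>X j\<close> of a common Euclidean space (every finite family of
  spaces \<open>\<real>\<^sup>n\<close> embeds this way). Matrices and vectors are padded with zeros outside \<open>E\<close> and \<open>NC\<close>.
\<close>

text \<open>The \<open>2 |S|\<close> entries of a stacked vector of D/Q pairs are indexed by pairs (element of \<open>S\<close>, D/Q component).\<close>

definition kronecker :: "real^'n^'m \<Rightarrow> real^'q^'p \<Rightarrow> real^('n \<times> 'q)^('m \<times> 'p)"
    (infixl "\<otimes>\<^sub>K" 75)
  where "A \<otimes>\<^sub>K B = (\<chi> r s. A $ fst r $ fst s * B $ snd r $ snd s)"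

definition I2 :: "real^2^2"
  where "I2 = mat 1"

definition J2 :: "real^2^2"
  where "J2 = vector [vector [0, 1], vector [- 1, 0]]"

definition block :: "real^('b::finite \<times> 2) \<Rightarrow> 'b \<Rightarrow> real^2"
  where "block v j = (\<chi> p. v $ (j, p))"

definition pos_diagonal_on :: "'a set \<Rightarrow> real^'a^'a \<Rightarrow> bool"
  where "pos_diagonal_on S M \<longleftrightarrow>
    (\<forall>i k. if i = k \<and> i \<in> S then M $ i $ k > 0 else M $ i $ k = 0)"

text \<open>Nodes are \<open>Inl j\<close> for buses and \<open>Inr c\<close> for internal capacitor nodes.\<close>

text \<open>The \<open>k\<close>-th node along a line with \<open>m\<close> subsections from bus \<open>a\<close> to bus \<open>b\<close>.\<close>

definition ladder_node :: "'b \<Rightarrow> 'b \<Rightarrow> (nat \<Rightarrow> 'c) \<Rightarrow> nat \<Rightarrow> nat \<Rightarrow> 'b + 'c"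
  where "ladder_node a b cap m k = (if k = 0 then Inl a else if k = m then Inl b else Inr (cap k))"

text \<open>
  There are finitely many lines \<open>l < n\<close>; line \<open>l\<close> is a ladder of \<open>m l \<ge> 1\<close> R-L subsections with
  \<open>m l - 1\<close> internal nodes. The edges \<open>E\<close> are exactly the subsections and the internal nodes \<open>NC\<close>
  exactly the junctions, without repetition. Edge directions are arbitrary. Self-loops are
  excluded since the incidence matrix is not well defined for them.
\<close>

definition rlc_ladder_network ::
    "'e set \<Rightarrow> 'c set \<Rightarrow> ('e \<Rightarrow> 'b + 'c) \<Rightarrow> ('e \<Rightarrow> 'b + 'c) \<Rightarrow> bool"
  where "rlc_ladder_network E NC tail head \<longleftrightarrow>
    (\<forall>e\<in>E. tail e \<noteq> head e) \<and>
    (\<exists>(n::nat) (m::nat \<Rightarrow> nat) (a::nat \<Rightarrow> 'b) (b::nat \<Rightarrow> 'b)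
        (edge::nat \<Rightarrow> nat \<Rightarrow> 'e) (cap::nat \<Rightarrow> nat \<Rightarrow> 'c).
      (\<forall>l<n. m l \<ge> 1) \<and>
      bij_betw (\<lambda>(l, k). edge l k) (SIGMA l:{..<n}. {1..m l}) E \<and>
      bij_betw (\<lambda>(l, k). cap l k) (SIGMA l:{..<n}. {1..<m l}) NC \<and>
      (\<forall>l<n. \<forall>k\<in>{1..m l}.
        {tail (edge l k), head (edge l k)} =
        {ladder_node (a l) (b l) (cap l) (m l) (k - 1), ladder_node (a l) (b l) (cap l) (m l) k}))"

definition incidence :: "'e set \<Rightarrow> ('e \<Rightarrow> 'v) \<Rightarrow> ('e \<Rightarrow> 'v) \<Rightarrow> real^'e^'v"
  where "incidence E tail head =
    (\<chi> i e. if e \<in> E \<and> tail e = i then 1 else if e \<in> E \<and> head e = i then - 1 else 0)"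

definition bus_rows :: "real^'e^('b::finite + 'c::finite) \<Rightarrow> real^'e^'b"
  where "bus_rows H = (\<chi> j. H $ Inl j)"

definition cap_rows :: "real^'e^('b::finite + 'c::finite) \<Rightarrow> real^'e^'c"
  where "cap_rows H = (\<chi> c. H $ Inr c)"

text \<open>Primed variables stand for time derivatives.\<close>

definition line_dynamics ::
    "real^'e^'e \<Rightarrow> real^'e^'e \<Rightarrow> real^'c^'c \<Rightarrow> real^'c^'c \<Rightarrow> real \<Rightarrow> real^'e^'b \<Rightarrow> real^'e^'c \<Rightarrow>
     real^('e::finite \<times> 2) \<Rightarrow> real^('c::finite \<times> 2) \<Rightarrow> real^('e \<times> 2) \<Rightarrow> real^('c \<times> 2) \<Rightarrow>
     real^('b::finite \<times> 2) \<Rightarrow> real^('b \<times> 2) \<Rightarrow> bool"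
  where "line_dynamics R L G C \<omega> HB HC IN VC IN' VC' VDQ IDQ \<longleftrightarrow>
    (L \<otimes>\<^sub>K I2) *v IN' =
      - ((R \<otimes>\<^sub>K I2 + \<omega> *\<^sub>R (L \<otimes>\<^sub>K J2)) *v IN) + (transpose HC \<otimes>\<^sub>K I2) *v VC
      + (transpose HB \<otimes>\<^sub>K I2) *v VDQ \<and>
    (C \<otimes>\<^sub>K I2) *v VC' =
      - ((G \<otimes>\<^sub>K I2 + \<omega> *\<^sub>R (C \<otimes>\<^sub>K J2)) *v VC) - (HC \<otimes>\<^sub>K I2) *v IN \<and>
    IDQ = (HB \<otimes>\<^sub>K I2) *v IN"

type_synonym ('e, 'c, 'x, 'b) network_state =
  "(real^('e \<times> 2)) \<times> (real^('c \<times> 2)) \<times> ('x^'b)"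

definition interconnection_dynamics ::
    "real^'e^'e \<Rightarrow> real^'e^'e \<Rightarrow> real^'c^'c \<Rightarrow> real^'c^'c \<Rightarrow> real \<Rightarrow> real^'e^'b \<Rightarrow> real^'e^'c \<Rightarrow>
     ('b \<Rightarrow> 'x \<Rightarrow> real^2 \<Rightarrow> 'x) \<Rightarrow> ('b \<Rightarrow> 'x \<Rightarrow> real^2 \<Rightarrow> real^2) \<Rightarrow>
     ('e::finite, 'c::finite, 'x, 'b::finite) network_state \<Rightarrow> ('e, 'c, 'x, 'b) network_state \<Rightarrow> bool"
  where "interconnection_dynamics R L G C \<omega> HB HC f g = (\<lambda>(IN, VC, x) (IN', VC', x').
    \<exists>VDQ IDQ w z.
      line_dynamics R L G C \<omega> HB HC IN VC IN' VC' VDQ IDQ \<and>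
      (\<forall>j. x' $ j = f j (x $ j) (w j) \<and> z j = g j (x $ j) (w j) \<and>
           w j = - block IDQ j \<and> block VDQ j = z j))"

definition interconnection_space ::
    "'e set \<Rightarrow> 'c set \<Rightarrow> ('b \<Rightarrow> 'x set) \<Rightarrow>
     ('e::finite, 'c::finite, 'x, 'b::finite) network_state set"
  where "interconnection_space E NC X =
    {(IN, VC, x). (\<forall>e p. e \<notin> E \<longrightarrow> IN $ (e, p) = 0) \<and>
                  (\<forall>c p. c \<notin> NC \<longrightarrow> VC $ (c, p) = 0) \<and> (\<forall>j. x $ j \<in> X j)}"

text \<open>
  A (possibly implicit) autonomous differential equation on a state space \<open>Q\<close> is given by a
  relation \<open>dyn\<close> between the state and its time derivative. Solutions need not be unique, so
  the stability properties below are required of all of them.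
\<close>

definition solution_on ::
    "'s::real_normed_vector set \<Rightarrow> ('s \<Rightarrow> 's \<Rightarrow> bool) \<Rightarrow> real set \<Rightarrow> (real \<Rightarrow> 's) \<Rightarrow> bool"
  where "solution_on Q dyn T q \<longleftrightarrow>
    (\<forall>t\<in>T. q t \<in> Q \<and> (\<exists>q'. (q has_vector_derivative q') (at t within T) \<and> dyn (q t) q'))"

definition equilibrium ::
    "'s::real_normed_vector set \<Rightarrow> ('s \<Rightarrow> 's \<Rightarrow> bool) \<Rightarrow> 's \<Rightarrow> bool"
  where "equilibrium Q dyn qs \<longleftrightarrow> qs \<in> Q \<and> dyn qs 0"

definition lyapunov_stable ::
    "'s::real_normed_vector set \<Rightarrow> ('s \<Rightarrow> 's \<Rightarrow> bool) \<Rightarrow> 's \<Rightarrow> bool"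
  where "lyapunov_stable Q dyn qs \<longleftrightarrow>
    (\<forall>\<epsilon>>0. \<exists>\<delta>>0. \<forall>\<tau>\<ge>0. \<forall>q. solution_on Q dyn {0..\<tau>} q \<and> dist (q 0) qs < \<delta> \<longrightarrow>
      (\<forall>t\<in>{0..\<tau>}. dist (q t) qs < \<epsilon>))"

text \<open>
  The existence clause makes explicit the usual convention that solutions starting near the
  equilibrium are defined for all \<open>t \<ge> 0\<close>, so that attractivity is not vacuous.
\<close>

definition asymptotically_stable ::
    "'s::real_normed_vector set \<Rightarrow> ('s \<Rightarrow> 's \<Rightarrow> bool) \<Rightarrow> 's \<Rightarrow> bool"
  where "asymptotically_stable Q dyn qs \<longleftrightarrow>
    equilibrium Q dyn qs \<and>
    lyapunov_stable Q dyn qs \<and>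
    (\<exists>\<delta>>0. \<forall>q0\<in>Q. dist q0 qs < \<delta> \<longrightarrow>
      (\<exists>q. solution_on Q dyn {0..} q \<and> q 0 = q0) \<and>
      (\<forall>q. solution_on Q dyn {0..} q \<and> q 0 = q0 \<longrightarrow> (q \<longlongrightarrow> qs) at_top))"

text \<open>Neighbourhoods and gradients in the state are taken relative to the subspace \<open>X\<close>.\<close>

definition has_C1_gradient_on ::
    "'x::euclidean_space set \<Rightarrow> 'x set \<Rightarrow> ('x \<Rightarrow> real) \<Rightarrow> ('x \<Rightarrow> 'x) \<Rightarrow> bool"
  where "has_C1_gradient_on X U V gradV \<longleftrightarrow>
    continuous_on U gradV \<and>
    (\<forall>x\<in>U. gradV x \<in> X \<and> (V has_derivative (\<lambda>h. gradV x \<bullet> h)) (at x within X))"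

definition positive_definite_map :: "('y::real_inner \<Rightarrow> 'y) \<Rightarrow> bool"
  where "positive_definite_map \<phi> \<longleftrightarrow> (\<forall>y. y \<noteq> 0 \<longrightarrow> y \<bullet> \<phi> y > 0)"

definition locally_output_strictly_passive_with ::
    "'x::euclidean_space set \<Rightarrow> ('x \<Rightarrow> real^2 \<Rightarrow> 'x) \<Rightarrow> ('x \<Rightarrow> real^2 \<Rightarrow> real^2) \<Rightarrow>
     real^2 \<Rightarrow> 'x \<Rightarrow> ('x \<Rightarrow> real) \<Rightarrow> bool"
  where "locally_output_strictly_passive_with X f g ws xs V \<longleftrightarrow>
    f xs ws = 0 \<and>
    (\<exists>W U gradV \<phi>.
      open W \<and> ws \<in> W \<and> openin (top_of_set X) U \<and> xs \<in> U \<and>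
      has_C1_gradient_on X U V gradV \<and> (\<forall>x\<in>U. V x \<ge> 0) \<and>
      positive_definite_map \<phi> \<and>
      (\<forall>w\<in>W. \<forall>x\<in>U. gradV x \<bullet> f x w \<le>
        (w - ws) \<bullet> (g x w - g xs ws) - (g x w - g xs ws) \<bullet> \<phi> (g x w - g xs ws)))"

definition locally_continuous :: "'x::euclidean_space set \<Rightarrow> ('x \<Rightarrow> real) \<Rightarrow> 'x \<Rightarrow> bool"
  where "locally_continuous X V xs \<longleftrightarrow>
    (\<exists>U. openin (top_of_set X) U \<and> xs \<in> U \<and> continuous_on U V)"

definition strict_local_min :: "'x::euclidean_space set \<Rightarrow> ('x \<Rightarrow> real) \<Rightarrow> 'x \<Rightarrow> bool"
  where "strict_local_min X V xs \<longleftrightarrow>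
    (\<exists>U. openin (top_of_set X) U \<and> xs \<in> U \<and> (\<forall>x\<in>U - {xs}. V xs < V x))"

end

theory Submission
  imports Defs
begin

text \<open>
  The Lyapunov function is the sum of the energy stored in the deviations of the line currents and
  capacitor voltages, with weights \<open>L\<close> and \<open>C\<close>, and of the storage functions of the buses. The lines
  are passive from bus voltages to bus currents: the rotation terms with \<open>J2\<close> are skew, the coupling
  of inductors and capacitors through \<open>HC\<close> and its transpose cancels, and the losses are the quadratic
  forms of \<open>R\<close> and \<open>G\<close> (\<open>line_energy_balance\<close>). The buses are passive from negative current to
  voltage, so in the sum the power exchanged at the buses cancels against their supply rates, and the
  function decreases at least as fast as the losses (\<open>interconnection_dissipation\<close>). It has a
  strict minimum at the equilibrium, which gives Lyapunov stability.

  Where the function is stationary, the losses vanish, so all currents and voltages of the lines have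
  their equilibrium values, since \<open>R\<close> and \<open>G\<close> are positive definite on the network. Then the bus
  inputs are constant, every bus evolves on its own, and its assumed asymptotic stability makes it
  converge. LaSalle's principle transfers this to all nearby trajectories.

  The output maps \<open>g\<close> are only continuous and so is the field of the interconnection; solutions need
  not be unique and the flow need not exist. The principle is therefore proved for solutions rather than
  for a flow (locale \<open>lasalle_system\<close>): a trajectory converges because a limit of its time translates is
  again a trajectory, on which the Lyapunov function is constant. Such limits, and the global
  solutions that asymptotic stability asks for, come from one compactness argument
  (\<open>solution_from_approximations\<close>), Peano's theorem being its application to Euler polygons.
\<close>

section \<open>Solutions as limits of approximate trajectories\<close>

text \<open>
  Compactness principle behind both uses of limits of trajectories: Euler polygons converge to a
  solution, and so do time translates of a bounded solution. The approximations \<open>u n\<close> may jump,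
  and a mean value inequality takes the place of continuity and differentiability, with an
  error \<open>h n\<close> that tends to zero. It bounds \<open>u n t\<close> for each fixed \<open>t\<close>, so by Tychonoff's theorem
  the sequence has a cluster point \<open>p\<close> in the product topology on \<open>real \<Rightarrow> 'a\<close>. Closeness at the two
  times \<open>s\<close> and \<open>t\<close> is all that the difference quotient of \<open>p\<close> involves, hence pointwise clustering
  is enough and no subsequence has to be extracted.
\<close>

lemma solution_from_approximations:
  fixes F :: "'a::euclidean_space \<Rightarrow> 'a" and u :: "nat \<Rightarrow> real \<Rightarrow> 'a"
  assumes "closed S" and contF: "continuous_on S F" and bound: "\<And>x. x \<in> S \<Longrightarrow> norm (F x) \<le> B"
    and h: "h \<longlonglongrightarrow> 0" "\<And>n. h n \<ge> 0"
    and start: "\<And>n. norm (u n 0) \<le> M"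
    and mem: "\<And>n t. t \<ge> 0 \<Longrightarrow> u n t \<in> S"
    and mean_value: "\<And>n s t v e. 0 \<le> s \<Longrightarrow> s \<le> t \<Longrightarrow>
      (\<And>r. s \<le> r \<Longrightarrow> r \<le> t \<Longrightarrow> norm (F (u n r) - v) \<le> e) \<Longrightarrow>
      norm (u n t - u n s - (t - s) *\<^sub>R v) \<le> (t - s) * e + h n * (e + norm v)"
  obtains p where "\<And>t. t \<ge> 0 \<Longrightarrow> p t \<in> S"
    and "\<And>t. t \<ge> 0 \<Longrightarrow> (p has_vector_derivative F (p t)) (at t within {0..})"
    and "\<And>t d N. t \<ge> 0 \<Longrightarrow> d > 0 \<Longrightarrow> \<exists>n\<ge>N. dist (u n t) (p t) < d"
proof -
  have B0: "B \<ge> 0"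
    using bound[OF mem[of 0 0]] norm_ge_zero[of "F (u 0 0)"] by linarith
  obtain h_max where h_max: "\<And>n. h n \<le> h_max"
    using convergent_imp_Bseq[OF convergentI[OF h(1)]]
    by (metis Bseq_def abs_le_D1 real_norm_def)
  have lip: "norm (u n t - u n s) \<le> (t - s) * B + h n * B" if "0 \<le> s" "s \<le> t" for n s t
    using mean_value[of s t n 0 B] that bound mem by simp
  \<comment> \<open>The product is indexed by all of \<open>real\<close>; negative times are frozen at time zero.\<close>
  define v where "v n t = u n (max 0 t)" for n t
  define K where "K t = S \<inter> cball 0 (M + max 0 t * B + h_max * B)" for t
  have vK: "v n t \<in> K t" for n t
  proof -
    have "norm (u n (max 0 t)) \<le> norm (u n 0) + norm (u n (max 0 t) - u n 0)"
      by (metis add.commute norm_triangle_sub)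
    also have "\<dots> \<le> M + (max 0 t * B + h_max * B)"
      using start[of n] lip[of 0 "max 0 t" n] mult_right_mono[OF h_max[of n] B0] by simp
    finally show ?thesis
      by (simp add: v_def K_def mem)
  qed
  have "compact (PiE UNIV K)"
  proof -
    have "compactin (product_topology (\<lambda>_. euclidean) UNIV) (PiE UNIV K)"
      by (subst compactin_PiE) (auto simp: K_def \<open>closed S\<close> closed_Int_compact)
    then show ?thesis
      by (simp add: euclidean_product_topology)
  qed
  moreover have "filtermap v sequentially \<noteq> bot"
    by (simp add: filtermap_bot_iff)
  moreover have "eventually (\<lambda>w. w \<in> PiE UNIV K) (filtermap v sequentially)"
    by (simp add: eventually_filtermap PiE_iff vK)
  ultimately obtain p where p: "p \<in> PiE UNIV K" "inf (nhds p) (filtermap v sequentially) \<noteq> bot"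
    unfolding compact_filter by metis
  have cluster: "\<exists>n\<ge>N. v n \<in> U" if "open U" "p \<in> U" for U N
  proof (rule ccontr)
    assume *: "\<not> ?thesis"
    have "eventually (\<lambda>w. w \<in> U) (nhds p)"
      using that by (simp add: eventually_nhds_in_open)
    moreover have "eventually (\<lambda>w. w \<notin> U) (filtermap v sequentially)"
      using * by (auto simp: eventually_filtermap eventually_sequentially)
    ultimately have "eventually (\<lambda>w. False) (inf (nhds p) (filtermap v sequentially))"
      unfolding eventually_inf by blast
    then show False
      using p(2) by (simp add: eventually_False)
  qed
  have open_coord: "open {w :: real \<Rightarrow> 'a. dist (w t) c < d}" for t c d
    by (intro open_Collect_less continuous_intros continuous_on_product_coordinates)
  have close2: "\<exists>n\<ge>N. dist (u n s) (p s) < d \<and> dist (u n t) (p t) < d"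
    if "0 \<le> s" "0 \<le> t" "d > 0" for s t d N
    using cluster[of "{w. dist (w s) (p s) < d} \<inter> {w. dist (w t) (p t) < d}" N] that
    by (auto simp: open_coord open_Int v_def max_absorb2)
  have pS: "p t \<in> S" for t
    using p(1) by (auto simp: K_def)
  have deriv: "(p has_vector_derivative F (p s)) (at s within {0..})" if "s \<ge> 0" for s
    unfolding has_vector_derivative_def has_derivative_within_alt
  proof (intro conjI allI impI)
    show "bounded_linear (\<lambda>x. x *\<^sub>R F (p s))"
      by (rule bounded_linear_scaleR_left)
    fix e :: real assume "e > 0"
    \<comment> \<open>Each \<open>u n\<close> moves with speed at most \<open>B\<close> up to the error, so over a time less than
      \<open>d / (2 * (B + 1))\<close> it covers at most half of the radius \<open>d\<close>. The other half absorbs the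
      tolerance \<open>k\<close>, which finally tends to zero.\<close>
    obtain d where d: "d > 0" "\<And>y. y \<in> S \<Longrightarrow> dist y (p s) < d \<Longrightarrow> dist (F y) (F (p s)) < e"
      using contF pS \<open>e > 0\<close> unfolding continuous_on_iff by metis
    show "\<exists>\<eta>>0. \<forall>t\<in>{0..}. norm (t - s) < \<eta> \<longrightarrow>
        norm (p t - p s - (t - s) *\<^sub>R F (p s)) \<le> e * norm (t - s)"
    proof (intro exI[of _ "d / (2 * (B + 1))"] conjI ballI impI)
      show "d / (2 * (B + 1)) > 0"
        using d B0 by simp
      fix t :: real assume t: "t \<in> {0..}" "norm (t - s) < d / (2 * (B + 1))"
      have "\<bar>t - s\<bar> * (2 * (B + 1)) < d"
        using t(2) B0 by (simp add: pos_less_divide_eq)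
      then have near: "\<bar>t - s\<bar> * B < d / 2"
        using abs_ge_zero[of "t - s"] by argo
      let ?c = "e + norm (F (p s)) + 2"
      have approx: "norm (p t - p s - (t - s) *\<^sub>R F (p s)) \<le> \<bar>t - s\<bar> * e + k * ?c"
        if k: "k > 0" "k * (B + 1) < d / 2" for k
      proof -
        obtain N where N: "\<And>n. n \<ge> N \<Longrightarrow> h n < k"
          using order_tendstoD(2)[OF h(1) k(1)] by (auto simp: eventually_sequentially)
        obtain n where n: "n \<ge> N" "dist (u n s) (p s) < k" "dist (u n t) (p t) < k"
          using close2[of s t k N] \<open>s \<ge> 0\<close> t k by auto
        have hk: "h n \<le> k"
          using N[OF n(1)] by simp
        define a b where "a = min s t" and "b = max s t"
        have ab: "0 \<le> a" "a \<le> b" "b - a = \<bar>t - s\<bar>"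
          using \<open>s \<ge> 0\<close> t by (auto simp: a_def b_def)
        have inside: "norm (F (u n r) - F (p s)) \<le> e" if r: "a \<le> r" "r \<le> b" for r
        proof -
          have "norm (u n r - u n s) \<le> \<bar>r - s\<bar> * B + h n * B"
          proof (cases "s \<le> r")
            case True
            then show ?thesis using lip[of s r n] \<open>s \<ge> 0\<close> by simp
          next
            case False
            then show ?thesis using lip[of r s n] r ab(1) by (simp add: norm_minus_commute)
          qed
          moreover have "\<bar>r - s\<bar> * B \<le> \<bar>t - s\<bar> * B" "h n * B \<le> k * B"
            using r B0 hk by (auto simp: a_def b_def intro!: mult_right_mono)
          ultimately have "dist (u n r) (u n s) + dist (u n s) (p s) < d"
            using near k n by (simp add: dist_norm algebra_simps)
          then have "dist (u n r) (p s) < d"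
            using dist_triangle[of "u n r" "p s" "u n s"] by simp
          moreover have "u n r \<in> S"
            using mem r ab by simp
          ultimately show ?thesis
            using d(2)[of "u n r"] by (simp add: dist_norm)
        qed
        have "norm (u n b - u n a - (b - a) *\<^sub>R F (p s)) \<le> (b - a) * e + h n * (e + norm (F (p s)))"
          by (rule mean_value) (use ab inside in auto)
        also have "\<dots> \<le> \<bar>t - s\<bar> * e + k * (e + norm (F (p s)))"
          using ab hk \<open>e > 0\<close> by (simp add: mult_right_mono)
        finally have "norm (u n b - u n a - (b - a) *\<^sub>R F (p s)) \<le> \<bar>t - s\<bar> * e + k * (e + norm (F (p s)))" .
        moreover have "norm (u n b - u n a - (b - a) *\<^sub>R F (p s)) = norm (u n t - u n s - (t - s) *\<^sub>R F (p s))"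
        proof (cases "s \<le> t")
          case True
          then show ?thesis by (simp add: a_def b_def)
        next
          case False
          then have "u n b - u n a - (b - a) *\<^sub>R F (p s) = - (u n t - u n s - (t - s) *\<^sub>R F (p s))"
            by (simp add: a_def b_def algebra_simps)
          then show ?thesis by (metis norm_minus_cancel)
        qed
        moreover have "norm (p t - p s - (t - s) *\<^sub>R F (p s)) \<le>
            norm (u n t - u n s - (t - s) *\<^sub>R F (p s)) + (dist (u n t) (p t) + dist (u n s) (p s))"
        proof -
          have "p t - p s - (t - s) *\<^sub>R F (p s) =
              (u n t - u n s - (t - s) *\<^sub>R F (p s)) + ((p t - u n t) + (u n s - p s))"
            by simp
          then show ?thesis
            by (metis (no_types, lifting) norm_triangle_le add_left_mono dist_commute dist_norm norm_triangle_ineq)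
        qed
        ultimately show ?thesis
          using n by (simp add: algebra_simps)
      qed
      have "((\<lambda>k. \<bar>t - s\<bar> * e + k * ?c) \<longlongrightarrow> \<bar>t - s\<bar> * e + 0 * ?c) (at_right 0)"
        by (intro tendsto_intros)
      moreover have "\<forall>\<^sub>F k in at_right 0. k > 0 \<and> k * (B + 1) < d / 2"
      proof (intro eventually_conj)
        show "\<forall>\<^sub>F k::real in at_right 0. k > 0"
          by (simp add: eventually_at_right_less)
        have "((\<lambda>k. k * (B + 1)) \<longlongrightarrow> 0 * (B + 1)) (at_right 0)"
          by (intro tendsto_intros)
        then show "\<forall>\<^sub>F k in at_right 0. k * (B + 1) < d / 2"
          using d(1) by (intro order_tendstoD) auto
      qed
      ultimately have "norm (p t - p s - (t - s) *\<^sub>R F (p s)) \<le> \<bar>t - s\<bar> * e + 0 * ?c"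
        by (intro tendsto_lowerbound) (auto elim!: eventually_mono intro: approx)
      then show "norm (p t - p s - (t - s) *\<^sub>R F (p s)) \<le> e * norm (t - s)"
        by (simp add: mult.commute)
    qed
  qed
  show ?thesis
  proof (rule that[OF pS deriv])
    show "\<exists>n\<ge>N. dist (u n t) (p t) < d" if "t \<ge> 0" "d > 0" for t d N
      using close2[of t t d N] that by blast
  qed
qed

text \<open>
  Euler's method with step \<open>1 / (n + 1)\<close>, read as a step function of time. On a time interval from
  \<open>s\<close> to \<open>t\<close> it takes \<open>m\<close> steps with \<open>m * h n\<close> equal to \<open>t - s\<close> up to one step length, which is the
  error term in the mean value inequality. A subspace that contains the values of \<open>F\<close> contains all
  Euler iterates.
\<close>

lemma peano_existence:
  fixes F :: "'a::euclidean_space \<Rightarrow> 'a"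
  assumes "subspace S" and "continuous_on S F" and bound: "\<And>x. x \<in> S \<Longrightarrow> norm (F x) \<le> B"
    and maps: "\<And>x. x \<in> S \<Longrightarrow> F x \<in> S" and "q0 \<in> S"
  obtains p where "p 0 = q0" "\<And>t. t \<ge> 0 \<Longrightarrow> p t \<in> S"
    and "\<And>t. t \<ge> 0 \<Longrightarrow> (p has_vector_derivative F (p t)) (at t within {0..})"
proof -
  define h where "h n = 1 / (real n + 1)" for n
  have h0: "h n > 0" for n
    by (simp add: h_def)
  define y where "y n = rec_nat q0 (\<lambda>_ x. x + h n *\<^sub>R F x)" for n
  have y_simps: "y n 0 = q0" "y n (Suc k) = y n k + h n *\<^sub>R F (y n k)" for n k
    by (simp_all add: y_def)
  have yS: "y n k \<in> S" for n k
    by (induction k)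
      (simp_all add: y_simps \<open>q0 \<in> S\<close> \<open>subspace S\<close> maps subspace_add subspace_scale)
  define u where "u n t = y n (nat \<lfloor>t / h n\<rfloor>)" for n t
  have mean_value: "norm (u n t - u n s - (t - s) *\<^sub>R v) \<le> (t - s) * e + h n * (e + norm v)"
    if st: "0 \<le> s" "s \<le> t" and near: "\<And>r. s \<le> r \<Longrightarrow> r \<le> t \<Longrightarrow> norm (F (u n r) - v) \<le> e" for n s t v e
  proof -
    have e0: "e \<ge> 0"
      using near[of s] st norm_ge_zero order_trans by blast
    define k m where "k = nat \<lfloor>s / h n\<rfloor>" and "m = nat \<lfloor>t / h n\<rfloor> - k"
    have "\<lfloor>s / h n\<rfloor> \<le> \<lfloor>t / h n\<rfloor>"
      using st h0[of n] by (intro floor_mono divide_right_mono) auto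
    then have km: "nat \<lfloor>t / h n\<rfloor> = k + m"
      by (simp add: k_def m_def)
    have s0: "0 \<le> s / h n" "0 \<le> t / h n"
      using st h0[of n] by auto
    have ks: "real k \<le> s / h n" "s / h n < real k + 1"
      using s0 unfolding k_def by linarith+
    have kt: "real (k + m) \<le> t / h n" "t / h n < real (k + m) + 1"
      using s0 km[symmetric] by linarith+
    have sum: "norm (y n (k + j) - y n k - (real j * h n) *\<^sub>R v) \<le> real j * h n * e" if "j \<le> m" for j
      using that
    proof (induction j)
      case (Suc j)
      \<comment> \<open>A time in the interval at which the step function has the value \<open>y n (k + j)\<close>: the grid point
        of index \<open>k\<close> may lie before \<open>s\<close>.\<close>
      define r where "r = max s (real (k + j) * h n)"
      have "real (k + j) * h n \<le> t"
      proof -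
        have "real (k + j) \<le> t / h n"
          using Suc.prems kt by linarith
        then show ?thesis
          using h0[of n] by (simp add: pos_le_divide_eq)
      qed
      then have r: "s \<le> r" "r \<le> t"
        using st by (auto simp: r_def)
      have "nat \<lfloor>r / h n\<rfloor> = k + j"
      proof (cases "s \<le> real (k + j) * h n")
        case True
        then have "r / h n = real (k + j)"
          using h0[of n] by (simp add: r_def)
        then show ?thesis by (simp only: floor_of_nat nat_int)
      next
        case False
        then have "real (k + j) < s / h n"
          using h0[of n] by (simp add: pos_less_divide_eq)
        with ks have "j = 0" by linarith
        with False show ?thesis by (simp add: r_def k_def)
      qed
      then have "norm (F (y n (k + j)) - v) \<le> e"
        using near[OF r] by (simp add: u_def)
      then have "norm (h n *\<^sub>R (F (y n (k + j)) - v)) \<le> h n * e"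
        using h0[of n] by simp
      moreover have "norm (y n (k + j) - y n k - (real j * h n) *\<^sub>R v) \<le> real j * h n * e"
        using Suc by simp
      moreover have "y n (k + Suc j) - y n k - (real (Suc j) * h n) *\<^sub>R v =
          (y n (k + j) - y n k - (real j * h n) *\<^sub>R v) + h n *\<^sub>R (F (y n (k + j)) - v)"
        by (simp add: y_simps algebra_simps)
      ultimately have "norm (y n (k + Suc j) - y n k - (real (Suc j) * h n) *\<^sub>R v)
          \<le> real j * h n * e + h n * e"
        by (simp only: norm_triangle_mono)
      then show ?case
        by (simp add: algebra_simps)
    qed simp
    have diff: "\<bar>real m * h n - (t - s)\<bar> \<le> h n"
    proof -
      have "\<bar>real m - (t / h n - s / h n)\<bar> \<le> 1"
        using ks kt by (simp add: abs_le_iff)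
      then have "\<bar>real m - (t / h n - s / h n)\<bar> * h n \<le> 1 * h n"
        using h0[of n] by (intro mult_right_mono) auto
      moreover have "\<bar>real m - (t / h n - s / h n)\<bar> * h n = \<bar>(real m - (t / h n - s / h n)) * h n\<bar>"
        using h0[of n] by (simp add: abs_mult)
      moreover have "(real m - (t / h n - s / h n)) * h n = real m * h n - (t - s)"
        using h0[of n] by (simp add: field_simps)
      ultimately show ?thesis by simp
    qed
    have "u n t - u n s - (t - s) *\<^sub>R v =
        (y n (k + m) - y n k - (real m * h n) *\<^sub>R v) + (real m * h n - (t - s)) *\<^sub>R v"
      using km by (simp add: u_def k_def algebra_simps)
    then have "norm (u n t - u n s - (t - s) *\<^sub>R v)
        \<le> real m * h n * e + \<bar>real m * h n - (t - s)\<bar> * norm v"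
      using sum[of m] by (simp only: norm_triangle_mono norm_scaleR order_refl)
    also have "\<dots> \<le> ((t - s) + h n) * e + h n * norm v"
      using diff e0 by (intro add_mono mult_right_mono) auto
    finally show ?thesis
      by (simp add: algebra_simps)
  qed
  have h_lim: "h \<longlonglongrightarrow> 0"
    unfolding h_def using LIMSEQ_inverse_real_of_nat by (simp add: inverse_eq_divide add.commute)
  show ?thesis
  proof (rule solution_from_approximations[OF closed_subspace[OF \<open>subspace S\<close>] assms(2) bound
        h_lim less_imp_le[OF h0] _ _ mean_value])
    show "norm (u n 0) \<le> norm q0" for n
      by (simp add: u_def y_simps)
    show "u n t \<in> S" for n t
      by (simp add: u_def yS)
    fix p
    assume p: "\<And>t. t \<ge> 0 \<Longrightarrow> p t \<in> S"
     "\<And>t. t \<ge> 0 \<Longrightarrow> (p has_vector_derivative F (p t)) (at t within {0..})"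
     "\<And>t d N. t \<ge> 0 \<Longrightarrow> d > 0 \<Longrightarrow> \<exists>n\<ge>N. dist (u n t) (p t) < d"
    have "dist q0 (p 0) < d" if "d > 0" for d
      using p(3)[of 0 d 0] that by (auto simp: u_def y_simps)
    then have "p 0 = q0"
      by (metis dist_eq_0_iff dist_pos_lt less_irrefl)
    then show ?thesis
      using that p(1,2) by blast
  qed
qed

section \<open>LaSalle's principle without uniqueness of solutions\<close>

text \<open>
  Turns the implicit equation into an explicit one: the velocity of a trajectory in the state space
  is itself in the state space, and there the implicit equation has only one solution.
\<close>

lemma vector_derivative_in_subspace:
  fixes p :: "real \<Rightarrow> 'a::euclidean_space"
  assumes "subspace S" and mem: "\<And>t. t \<in> T \<Longrightarrow> p t \<in> S" and "t \<in> T"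
    and nontrivial: "at t within T \<noteq> bot"
    and deriv: "(p has_vector_derivative d) (at t within T)"
  shows "d \<in> S"
proof -
  have "((\<lambda>s. norm ((p s - p t - (s - t) *\<^sub>R d) /\<^sub>R norm (s - t))) \<longlongrightarrow> 0) (at t within T)"
    using deriv by (simp add: has_vector_derivative_def has_derivative_iff_norm divide_inverse mult.commute)
  moreover have "\<forall>\<^sub>F s in at t within T. norm ((p s - p t - (s - t) *\<^sub>R d) /\<^sub>R norm (s - t)) =
      norm ((p s - p t) /\<^sub>R (s - t) - d)"
  proof (rule eventually_at_topological[THEN iffD2], intro exI[of _ UNIV] conjI ballI impI)
    fix s assume "s \<noteq> t"
    then have "(p s - p t) /\<^sub>R (s - t) - d = (p s - p t - (s - t) *\<^sub>R d) /\<^sub>R (s - t)"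
      by (simp add: scaleR_diff_right)
    then show "norm ((p s - p t - (s - t) *\<^sub>R d) /\<^sub>R norm (s - t)) = norm ((p s - p t) /\<^sub>R (s - t) - d)"
      by simp
  qed auto
  ultimately have "((\<lambda>s. norm ((p s - p t) /\<^sub>R (s - t) - d)) \<longlongrightarrow> 0) (at t within T)"
    by (rule Lim_transform_eventually)
  then have lim: "((\<lambda>s. (p s - p t) /\<^sub>R (s - t)) \<longlongrightarrow> d) (at t within T)"
    by (rule LIM_zero_cancel[OF tendsto_norm_zero_cancel])
  have "\<forall>\<^sub>F s in at t within T. (p s - p t) /\<^sub>R (s - t) \<in> S"
    unfolding eventually_at_topological
    using mem \<open>t \<in> T\<close> \<open>subspace S\<close>
    by (intro exI[of _ UNIV]) (auto intro: subspace_scale subspace_diff)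
  then show ?thesis
    using Lim_in_closed_set[OF closed_subspace[OF \<open>subspace S\<close>] _ nontrivial lim] by simp
qed

text \<open>
  Local form of LaSalle's principle for an equation that is given implicitly and whose field \<open>F\<close> is
  merely continuous, so that solutions need not be unique. \<open>W\<close> is the Lyapunov function, \<open>Z\<close> a
  superset of the states in which it is stationary; every trajectory inside \<open>Z\<close> must converge.
\<close>

locale lasalle_system =
  fixes Q :: "'s::euclidean_space set" and dyn :: "'s \<Rightarrow> 's \<Rightarrow> bool" and F :: "'s \<Rightarrow> 's"
    and W :: "'s \<Rightarrow> real" and Z :: "'s set" and qs :: 's and r :: real
  assumes space: "subspace Q" and qs: "qs \<in> Q" and r: "r > 0"
    and dyn_iff: "\<And>q q'. q \<in> Q \<Longrightarrow> q' \<in> Q \<Longrightarrow> dyn q q' \<longleftrightarrow> q' = F q"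
    and F_continuous: "continuous_on Q F"
    and F_maps: "\<And>q. q \<in> Q \<Longrightarrow> F q \<in> Q"
    and F_qs: "F qs = 0"
    and W_derivative: "\<And>q. q \<in> Q \<inter> cball qs r \<Longrightarrow>
      \<exists>W'. (W has_derivative W') (at q within Q) \<and> W' (F q) \<le> 0 \<and> (W' (F q) = 0 \<longrightarrow> q \<in> Z)"
    and W_strict_min: "\<And>q. q \<in> Q \<inter> cball qs r \<Longrightarrow> q \<noteq> qs \<Longrightarrow> W qs < W q"
    and residual_attracts: "\<And>p. solution_on Q dyn {0..} p \<Longrightarrow>
      (\<And>t. t \<ge> 0 \<Longrightarrow> p t \<in> Z \<inter> cball qs r) \<Longrightarrow> (p \<longlongrightarrow> qs) at_top"
begin

lemma solution_on_field_iff: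
  assumes "\<And>t. t \<in> T \<Longrightarrow> at t within T \<noteq> bot"
  shows "solution_on Q dyn T q \<longleftrightarrow>
    (\<forall>t\<in>T. q t \<in> Q \<and> (q has_vector_derivative F (q t)) (at t within T))"
proof
  assume sol: "solution_on Q dyn T q"
  show "\<forall>t\<in>T. q t \<in> Q \<and> (q has_vector_derivative F (q t)) (at t within T)"
  proof
    fix t assume t: "t \<in> T"
    then obtain q' where q': "q t \<in> Q" "(q has_vector_derivative q') (at t within T)" "dyn (q t) q'"
      using sol unfolding solution_on_def by blast
    have "q' \<in> Q"
      using sol by (intro vector_derivative_in_subspace[OF space _ t assms[OF t] q'(2)])
        (auto simp: solution_on_def)
    then show "q t \<in> Q \<and> (q has_vector_derivative F (q t)) (at t within T)"
      using q' dyn_iff by blast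
  qed
next
  assume "\<forall>t\<in>T. q t \<in> Q \<and> (q has_vector_derivative F (q t)) (at t within T)"
  then show "solution_on Q dyn T q"
    unfolding solution_on_def using dyn_iff F_maps by blast
qed

text \<open>
  The chain rule for a curve in the state space that is tangent to the field at the single time \<open>t\<close>;
  the trapping argument below applies it to solutions of a field that differs from \<open>F\<close> elsewhere.
\<close>

lemma W_along_solution:
  assumes "t \<in> T" and "\<And>s. s \<in> T \<Longrightarrow> q s \<in> Q" and "q t \<in> cball qs r"
    and "(q has_vector_derivative F (q t)) (at t within T)"
  obtains y where "y \<le> 0" "y = 0 \<Longrightarrow> q t \<in> Z"
    and "((\<lambda>s. W (q s)) has_derivative (\<lambda>h. h * y)) (at t within T)"
proof -
  obtain W' where W': "(W has_derivative W') (at (q t) within Q)"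
      "W' (F (q t)) \<le> 0" "W' (F (q t)) = 0 \<longrightarrow> q t \<in> Z"
    using W_derivative[of "q t"] assms(1-3) by blast
  interpret W': bounded_linear W'
    using W'(1) by (rule has_derivative_bounded_linear)
  have "((\<lambda>s. W (q s)) has_derivative (\<lambda>h. W' (h *\<^sub>R F (q t)))) (at t within T)"
    by (rule has_derivative_in_compose[OF assms(4)[unfolded has_vector_derivative_def]
        has_derivative_subset[OF W'(1)]]) (use assms(2) in auto)
  then show ?thesis
    using W' by (intro that[of "W' (F (q t))"]) (simp_all add: W'.scaleR)
qed

lemma W_nonincreasing:
  assumes "a \<le> b" and q: "\<And>t. t \<in> {a..b} \<Longrightarrow> q t \<in> Q \<inter> cball qs r"
    and deriv: "\<And>t. t \<in> {a..b} \<Longrightarrow> (q has_vector_derivative F (q t)) (at t within {a..b})"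
  shows "W (q b) \<le> W (q a)"
proof -
  have "\<exists>y\<le>0. ((\<lambda>s. W (q s)) has_derivative (\<lambda>h. h * y)) (at t within {a..b})" if "t \<in> {a..b}" for t
    using W_along_solution[of t "{a..b}" q] that q deriv by blast
  then obtain y where y: "\<And>t. t \<in> {a..b} \<Longrightarrow> y t \<le> 0"
      "\<And>t. t \<in> {a..b} \<Longrightarrow> ((\<lambda>s. W (q s)) has_derivative (\<lambda>h. h * y t)) (at t within {a..b})"
    by metis
  obtain t where "t \<in> {a..b}" "W (q b) - W (q a) = (b - a) * y t"
    using mvt_very_simple[OF \<open>a \<le> b\<close>, of "\<lambda>s. W (q s)" "\<lambda>t h. h * y t"] y(2) by auto
  then show ?thesis
    using y(1)[of t] \<open>a \<le> b\<close> mult_nonneg_nonpos[of "b - a" "y t"] by simp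
qed

lemma W_continuous: "continuous_on (Q \<inter> cball qs r) W"
  unfolding continuous_on_eq_continuous_within
proof
  fix q assume "q \<in> Q \<inter> cball qs r"
  then obtain W' where "(W has_derivative W') (at q within Q)"
    using W_derivative[of q] by blast
  then show "continuous (at q within Q \<inter> cball qs r) W"
    by (rule continuous_within_subset[OF has_derivative_continuous]) simp
qed

lemma compact_neighbourhood: "compact (Q \<inter> cball qs r)"
  using closed_subspace[OF space] by (simp add: closed_Int_compact)

text \<open>
  Compactness makes the strict minimum uniform outside each ball around the equilibrium.
\<close>

lemma W_gap:
  assumes "e > 0"
  obtains m where "m > W qs" and "\<And>q. q \<in> Q \<inter> cball qs r \<Longrightarrow> dist q qs \<ge> e \<Longrightarrow> m \<le> W q"
proof -
  let ?A = "(Q \<inter> cball qs r) - ball qs e"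
  show ?thesis
  proof (cases "?A = {}")
    case True
    then show ?thesis
      by (intro that[of "W qs + 1"]) (auto simp: dist_commute)
  next
    case False
    have "compact ?A"
      by (intro compact_diff compact_neighbourhood open_ball)
    then obtain q where q: "q \<in> ?A" "\<And>q'. q' \<in> ?A \<Longrightarrow> W q \<le> W q'"
      using continuous_attains_inf[OF _ False continuous_on_subset[OF W_continuous]] by blast
    then have "q \<noteq> qs"
      using assms by auto
    then show ?thesis
      using q by (intro that[of "W q"] W_strict_min) (auto simp: dist_commute)
  qed
qed

text \<open>
  The level argument for Lyapunov stability: if \<open>W\<close> starts below its minimum on the sphere of radius
  \<open>e\<close>, it cannot reach the sphere since it does not increase before. The curve has to follow the
  field only while it is in the ball of radius \<open>r\<close>, so that the lemma also covers solutions of a field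
  that has been modified outside that ball.
\<close>

lemma trapping:
  assumes "0 < e" "e \<le> r"
  shows "\<exists>d>0. \<forall>\<tau> q. (\<forall>s\<in>{0..\<tau>}. q s \<in> Q) \<and> continuous_on {0..\<tau>} q \<and>
      (\<forall>s\<in>{0..\<tau>}. dist (q s) qs \<le> r \<longrightarrow> (q has_vector_derivative F (q s)) (at s within {0..\<tau>})) \<and>
      dist (q 0) qs < d \<longrightarrow> (\<forall>t\<in>{0..\<tau>}. dist (q t) qs < e)"
proof -
  obtain m where m: "m > W qs" "\<And>q. q \<in> Q \<inter> cball qs r \<Longrightarrow> dist q qs \<ge> e \<Longrightarrow> m \<le> W q"
    using W_gap[OF \<open>0 < e\<close>] by metis
  obtain d0 where d0: "d0 > 0"
      "\<And>q. q \<in> Q \<inter> cball qs r \<Longrightarrow> dist q qs < d0 \<Longrightarrow> dist (W q) (W qs) < m - W qs"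
    using W_continuous m(1) qs r unfolding continuous_on_iff
    by (metis IntI centre_in_cball diff_gt_0_iff_gt less_imp_le)
  show ?thesis
  proof (intro exI[of _ "min d0 e"] conjI allI impI ballI)
    show "min d0 e > 0"
      using d0(1) assms by simp
    fix \<tau> q t
    assume *: "(\<forall>s\<in>{0..\<tau>}. q s \<in> Q) \<and> continuous_on {0..\<tau>} q \<and>
      (\<forall>s\<in>{0..\<tau>}. dist (q s) qs \<le> r \<longrightarrow> (q has_vector_derivative F (q s)) (at s within {0..\<tau>})) \<and>
      dist (q 0) qs < min d0 e" and t: "t \<in> {0..\<tau>}"
    then have Q: "\<And>s. s \<in> {0..\<tau>} \<Longrightarrow> q s \<in> Q" and cont: "continuous_on {0..\<tau>} q"
      and deriv: "\<And>s. s \<in> {0..\<tau>} \<Longrightarrow> dist (q s) qs \<le> r \<Longrightarrow>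
        (q has_vector_derivative F (q s)) (at s within {0..\<tau>})"
      and start: "dist (q 0) qs < min d0 e"
      by blast+
    show "dist (q t) qs < e"
    proof (rule ccontr)
      assume "\<not> dist (q t) qs < e"
      moreover have cont_t: "continuous_on {0..t} (\<lambda>s. dist (q s) qs)"
        using t by (intro continuous_intros continuous_on_subset[OF cont]) auto
      ultimately obtain s0 where s0: "0 \<le> s0" "s0 \<le> t" "dist (q s0) qs = e"
        using IVT'[of "\<lambda>s. dist (q s) qs" 0 e t] start t by auto
      define A where "A = {s \<in> {0..t}. dist (q s) qs = e}"
      have "closed A"
        unfolding A_def by (rule continuous_closed_preimage_constant[OF cont_t]) simp
      then have "compact A"
        by (metis (no_types, lifting) A_def bounded_closed_interval bounded_subset compact_eq_bounded_closed mem_Collect_eq subsetI)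
      moreover have "A \<noteq> {}"
        using s0 by (auto simp: A_def)
      ultimately obtain t0 where t0: "t0 \<in> A" "\<And>s. s \<in> A \<Longrightarrow> t0 \<le> s"
        using compact_attains_inf by metis
      \<comment> \<open>The first arrival time \<open>t0\<close> at the sphere: before it, the curve stays inside.\<close>
      have inside: "dist (q s) qs \<le> e" if s: "s \<in> {0..t0}" for s
      proof (rule ccontr)
        assume outside: "\<not> dist (q s) qs \<le> e"
        moreover have "continuous_on {0..s} (\<lambda>s. dist (q s) qs)"
          using s t0(1) by (intro continuous_on_subset[OF cont_t]) (auto simp: A_def)
        ultimately obtain s' where s': "0 \<le> s'" "s' \<le> s" "dist (q s') qs = e"
          using IVT'[of "\<lambda>s. dist (q s) qs" 0 e s] start s by auto
        then have "t0 \<le> s'"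
          using t0 s by (auto simp: A_def)
        then have "s = s'"
          using s s' by auto
        then show False
          using s' outside by simp
      qed
      have sub: "{0..t0} \<subseteq> {0..\<tau>}"
        using t0(1) t by (auto simp: A_def)
      have "W (q t0) \<le> W (q 0)"
      proof (rule W_nonincreasing)
        show "0 \<le> t0"
          using t0(1) by (auto simp: A_def)
        fix s assume s: "s \<in> {0..t0}"
        show "q s \<in> Q \<inter> cball qs r"
          using inside[OF s] Q sub s \<open>e \<le> r\<close> by (auto simp: dist_commute)
        show "(q has_vector_derivative F (q s)) (at s within {0..t0})"
          by (rule has_vector_derivative_within_subset[OF deriv sub])
             (use inside[OF s] sub s \<open>e \<le> r\<close> in auto)
      qed
      also have "W (q 0) < m"
        using d0(2)[of "q 0"] start Q[of 0] t \<open>e \<le> r\<close>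
        by (force simp: dist_commute dist_real_def)
      also have "m \<le> W (q t0)"
        using m(2)[of "q t0"] t0(1) Q[of t0] t \<open>e \<le> r\<close> by (auto simp: A_def dist_commute)
      finally show False by simp
    qed
  qed
qed

lemma lyapunov_stable: "lyapunov_stable Q dyn qs"
  unfolding lyapunov_stable_def
proof (intro allI impI)
  fix e :: real assume "e > 0"
  then obtain d where d: "d > 0" and trap: "\<forall>\<tau> q. (\<forall>s\<in>{0..\<tau>}. q s \<in> Q) \<and> continuous_on {0..\<tau>} q \<and>
      (\<forall>s\<in>{0..\<tau>}. dist (q s) qs \<le> r \<longrightarrow> (q has_vector_derivative F (q s)) (at s within {0..\<tau>})) \<and>
      dist (q 0) qs < d \<longrightarrow> (\<forall>t\<in>{0..\<tau>}. dist (q t) qs < min e r)"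
    using trapping[of "min e r"] r \<open>e > 0\<close> by auto
  show "\<exists>\<delta>>0. \<forall>\<tau>\<ge>0. \<forall>q. solution_on Q dyn {0..\<tau>} q \<and> dist (q 0) qs < \<delta> \<longrightarrow>
      (\<forall>t\<in>{0..\<tau>}. dist (q t) qs < e)"
  proof (intro exI[of _ "min d e"] conjI allI impI ballI)
    show "min d e > 0"
      using d \<open>e > 0\<close> by simp
    fix \<tau> :: real and q t
    assume \<tau>: "\<tau> \<ge> 0" and *: "solution_on Q dyn {0..\<tau>} q \<and> dist (q 0) qs < min d e" and t: "t \<in> {0..\<tau>}"
    show "dist (q t) qs < e"
    proof (cases "\<tau> = 0")
      case True
      then show ?thesis using * t by simp
    next
      case False
      then have sol: "q s \<in> Q" "(q has_vector_derivative F (q s)) (at s within {0..\<tau>})" if "s \<in> {0..\<tau>}" for s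
        using * that \<tau> solution_on_field_iff[of "{0..\<tau>}" q] by (auto simp: trivial_limit_within)
      then have "continuous_on {0..\<tau>} q"
        by (intro continuous_on_vector_derivative)
      then show ?thesis
        using trap[rule_format, of \<tau> q t] sol * t by simp
    qed
  qed
qed

text \<open>
  Existence: composing \<open>F\<close> with the nearest-point projection onto the compact neighbourhood gives a
  bounded field with a global solution, which trapping confines to the region where nothing was
  changed.
  
  Attraction: along a solution \<open>q\<close> the function \<open>W\<close> decreases to a limit \<open>c\<close>. A cluster point \<open>p\<close> of
  the translates of \<open>q\<close> by \<open>n\<close> is again a solution and \<open>W\<close> has the constant value \<open>c\<close> along it, so \<open>p\<close> stays
  in \<open>Z\<close> and converges to \<open>qs\<close>. Hence \<open>c = W qs\<close>, and as \<open>W\<close> has a strict minimum at \<open>qs\<close>, the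
  solution \<open>q\<close> itself converges to \<open>qs\<close>.
\<close>

lemma asymptotically_stable: "asymptotically_stable Q dyn qs"
proof -
  have half_line: "at t within {0..} \<noteq> bot" if "t \<in> {0..}" for t :: real
    using islimpt_subset[of t "{0..t + 1}" "{0..}"] that by (auto simp: trivial_limit_within)
  have solution_iff: "solution_on Q dyn {0..} q \<longleftrightarrow>
      (\<forall>t\<in>{0..}. q t \<in> Q \<and> (q has_vector_derivative F (q t)) (at t within {0..}))" for q
    by (rule solution_on_field_iff[OF half_line])
  obtain d where d: "d > 0" and trap: "\<forall>\<tau> q. (\<forall>s\<in>{0..\<tau>}. q s \<in> Q) \<and> continuous_on {0..\<tau>} q \<and>
      (\<forall>s\<in>{0..\<tau>}. dist (q s) qs \<le> r \<longrightarrow> (q has_vector_derivative F (q s)) (at s within {0..\<tau>})) \<and>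
      dist (q 0) qs < d \<longrightarrow> (\<forall>t\<in>{0..\<tau>}. dist (q t) qs < r)"
    using trapping[of "r"] r by auto
  have stays: "dist (q t) qs < r"
    if "\<And>s. s \<ge> 0 \<Longrightarrow> q s \<in> Q" "dist (q 0) qs < d" "t \<ge> 0"
      "\<And>s. s \<ge> 0 \<Longrightarrow> (q has_vector_derivative F' (q s)) (at s within {0..})"
      "\<And>x. x \<in> Q \<inter> cball qs r \<Longrightarrow> F' x = F x" for q t F'
  proof (rule trap[rule_format, of t q t], intro conjI ballI impI)
    have deriv: "(q has_vector_derivative F' (q s)) (at s within {0..t})" if "s \<in> {0..t}" for s
      by (rule has_vector_derivative_within_subset[of q _ s "{0..}"])
        (use that \<open>\<And>s. s \<ge> 0 \<Longrightarrow> (q has_vector_derivative F' (q s)) (at s within {0..})\<close> in auto)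
    then show "continuous_on {0..t} q"
      by (rule continuous_on_vector_derivative)
    show "(q has_vector_derivative F (q s)) (at s within {0..t})" if "s \<in> {0..t}" "dist (q s) qs \<le> r" for s
      using deriv[of s] that(1,2) \<open>\<And>s. s \<ge> 0 \<Longrightarrow> q s \<in> Q\<close>
        \<open>\<And>x. x \<in> Q \<inter> cball qs r \<Longrightarrow> F' x = F x\<close>[of "q s"] by (simp add: dist_commute)
  qed (use that in auto)
  let ?K = "Q \<inter> cball qs r"
  obtain B where B: "\<And>x. x \<in> ?K \<Longrightarrow> norm (F x) \<le> B"
  proof -
    have "compact (F ` ?K)"
      using compact_neighbourhood F_continuous
      by (metis compact_continuous_image continuous_on_subset inf_le1)
    then show ?thesis
      using that compact_imp_bounded bounded_iff by (metis image_eqI)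
  qed
  have existence: "\<exists>q. solution_on Q dyn {0..} q \<and> q 0 = q0" if q0: "q0 \<in> Q" "dist q0 qs < d" for q0
  proof -
    have K: "convex ?K" "closed ?K" "?K \<noteq> {}"
      using subspace_imp_convex[OF space] closed_subspace[OF space] qs r
      by (auto simp: convex_Int closed_Int intro!: exI[of _ qs])
    \<comment> \<open>Boundedness of the modified field excludes blow-up.\<close>
    define F' where "F' x = F (closest_point ?K x)" for x
    have in_K: "closest_point ?K x \<in> ?K" for x
      by (rule closest_point_in_set[OF K(2,3)])
    have "continuous_on Q F'"
      unfolding F'_def
      by (rule continuous_on_compose2[OF F_continuous continuous_on_closest_point[OF K]]) (use in_K in auto)
    moreover have "norm (F' x) \<le> B" for x
      unfolding F'_def by (rule B[OF in_K])
    moreover have "F' x \<in> Q" for x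
      unfolding F'_def using F_maps in_K by blast
    ultimately obtain p where p: "p 0 = q0" "\<And>t. t \<ge> 0 \<Longrightarrow> p t \<in> Q"
        "\<And>t. t \<ge> 0 \<Longrightarrow> (p has_vector_derivative F' (p t)) (at t within {0..})"
      using peano_existence[OF space _ _ _ q0(1), of F' B] by metis
    have F'_eq: "F' x = F x" if "x \<in> ?K" for x
      unfolding F'_def using that by (simp only: closest_point_self)
    have pK: "p t \<in> ?K" if "t \<ge> 0" for t
      using stays[of p t F', OF p(2) _ that p(3) F'_eq] p q0(2) that by (simp add: dist_commute)
    have "p t \<in> Q \<and> (p has_vector_derivative F (p t)) (at t within {0..})" if "t \<in> {0..}" for t
      using p(2,3)[of t] F'_eq[OF pK[of t]] that by simp
    then have "solution_on Q dyn {0..} p"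
      unfolding solution_iff by (rule ballI)
    then show ?thesis
      using p(1) by (intro exI[of _ p] conjI)
  qed
  have attraction: "(q \<longlongrightarrow> qs) at_top" if sol: "solution_on Q dyn {0..} q" and q0: "dist (q 0) qs < d" for q
  proof -
    have q: "q t \<in> Q" "(q has_vector_derivative F (q t)) (at t within {0..})" if "t \<ge> 0" for t
      using sol[unfolded solution_iff] that by auto
    have qK: "q t \<in> ?K" if "t \<ge> 0" for t
      using stays[of q t F, OF q(1) q0 that q(2)] q(1)[OF that] by (simp add: dist_commute)
    have deriv: "(q has_vector_derivative F (q t)) (at t within {a..b})" if "0 \<le> a" "t \<in> {a..b}" for a b t
      by (rule has_vector_derivative_within_subset[of q _ t "{0..}"]) (use q(2)[of t] that in auto)
    have W_mono: "W (q b) \<le> W (q a)" if "0 \<le> a" "a \<le> b" for a b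
      using that qK deriv by (intro W_nonincreasing) auto
    have W_ge: "W qs \<le> W (q t)" if "t \<ge> 0" for t
      using W_strict_min[OF qK[OF that]] by (cases "q t = qs") auto
    define c where "c = Inf ((\<lambda>t. W (q t)) ` {0..})"
    have bdd: "bdd_below ((\<lambda>t. W (q t)) ` {0..})"
      using W_ge by (intro bdd_belowI[of _ "W qs"]) auto
    have c_le: "c \<le> W (q t)" if "t \<ge> 0" for t
      unfolding c_def using bdd that by (intro cInf_lower) auto
    have W_lim: "\<exists>T\<ge>0. \<forall>t\<ge>T. W (q t) < c + e" if e: "e > 0" for e
    proof -
      obtain T where "T \<ge> 0" "W (q T) < c + e"
        using cInf_lessD[of "(\<lambda>t. W (q t)) ` {0..}" "c + e"] e unfolding c_def by auto
      then show ?thesis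
        using W_mono by (metis le_less_trans order_trans)
    qed
    define u where "u n t = q (real n + t)" for n t
    have mean_value: "norm (u n t - u n s - (t - s) *\<^sub>R v) \<le> (t - s) * e + 0 * (e + norm v)"
      if st: "0 \<le> s" "s \<le> t" and near: "\<And>r. s \<le> r \<Longrightarrow> r \<le> t \<Longrightarrow> norm (F (u n r) - v) \<le> e" for n s t v e
    proof -
      let ?a = "real n + s" and ?b = "real n + t"
      have "norm ((q ?b - ?b *\<^sub>R v) - (q ?a - ?a *\<^sub>R v)) \<le> e * norm (?b - ?a)"
      proof (rule differentiable_bound[of "{?a..?b}"])
        fix x assume x: "x \<in> {?a..?b}"
        show "((\<lambda>x. q x - x *\<^sub>R v) has_derivative (\<lambda>h. h *\<^sub>R (F (q x) - v))) (at x within {?a..?b})"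
          using deriv[of ?a x ?b] x st unfolding has_vector_derivative_def
          by (auto intro!: derivative_eq_intros simp: algebra_simps)
        have "norm (F (q x) - v) \<le> e"
          using near[of "x - real n"] x by (simp add: u_def)
        then show "onorm (\<lambda>h. h *\<^sub>R (F (q x) - v)) \<le> e"
          by (intro onorm_le) (simp add: mult_left_mono mult.commute[of e])
      qed (use st in auto)
      moreover have "(q ?b - ?b *\<^sub>R v) - (q ?a - ?a *\<^sub>R v) = u n t - u n s - (t - s) *\<^sub>R v"
        by (simp add: u_def algebra_simps)
      ultimately show ?thesis
        using st by (simp add: mult.commute)
    qed
    show ?thesis
    proof (rule solution_from_approximations[of ?K F B "\<lambda>_. 0" u "norm qs + r"])
      show "norm (u n 0) \<le> norm qs + r" for n
        using qK[of "real n"] norm_triangle_sub[of "q (real n)" qs]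
        by (simp add: u_def dist_norm norm_minus_commute)
      fix p
      assume p: "\<And>t. t \<ge> 0 \<Longrightarrow> p t \<in> ?K"
          "\<And>t. t \<ge> 0 \<Longrightarrow> (p has_vector_derivative F (p t)) (at t within {0..})"
        and cluster: "\<And>t d N. t \<ge> 0 \<Longrightarrow> d > 0 \<Longrightarrow> \<exists>n\<ge>N. dist (u n t) (p t) < d"
      have Wp: "W (p t) = c" if t: "t \<ge> 0" for t
      proof -
        have "\<bar>W (p t) - c\<bar> < 2 * e" if e: "e > 0" for e
        proof -
          obtain d where d: "d > 0" "\<And>x. x \<in> ?K \<Longrightarrow> dist x (p t) < d \<Longrightarrow> dist (W x) (W (p t)) < e"
            using W_continuous p(1)[OF t] e unfolding continuous_on_iff by metis
          obtain T where T: "T \<ge> 0" "\<And>t. t \<ge> T \<Longrightarrow> W (q t) < c + e"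
            using W_lim[OF e] by blast
          obtain n where n: "n \<ge> nat \<lceil>T\<rceil>" "dist (u n t) (p t) < d"
            using cluster[OF t d(1)] by blast
          have "real n + t \<ge> T"
            using n(1) t by linarith
          then have "W (u n t) < c + e" "c \<le> W (u n t)" "u n t \<in> ?K"
            using T c_le[of "real n + t"] qK[of "real n + t"] by (auto simp: u_def)
          then show ?thesis
            using d(2)[of "u n t"] n(2) by (simp add: dist_real_def)
        qed
        from this[of "\<bar>W (p t) - c\<bar> / 2"] show ?thesis
          by (cases "W (p t) = c") auto
      qed
      have pZ: "p t \<in> Z \<inter> cball qs r" if t: "t \<ge> 0" for t
      proof -
        obtain y where y: "y = 0 \<Longrightarrow> p t \<in> Z"
          "((\<lambda>s. W (p s)) has_derivative (\<lambda>h. h * y)) (at t within {0..})"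
          using W_along_solution[of t "{0..}" p] p t by (metis IntD1 IntD2 atLeast_iff)
        have "((\<lambda>s. W (p s)) has_vector_derivative y) (at t within {0..})"
          using y(2) by (simp add: has_vector_derivative_def)
        moreover have "((\<lambda>s. W (p s)) has_vector_derivative 0) (at t within {0..})"
          by (rule has_vector_derivative_transform[of _ _ _ "\<lambda>_. c"]) (use t Wp in auto)
        ultimately have "y = 0"
          using vector_derivative_unique_within[OF half_line] t by auto
        then show ?thesis
          using y p(1)[OF t] by blast
      qed
      have "solution_on Q dyn {0..} p"
        unfolding solution_iff using p by auto
      then have p_lim: "(p \<longlongrightarrow> qs) at_top"
        using residual_attracts pZ by blast
      have c: "c = W qs"
      proof -
        have "((\<lambda>t. W (p t)) \<longlongrightarrow> W qs) at_top"
        proof (rule continuous_on_tendsto_compose[OF W_continuous p_lim])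
          show "qs \<in> ?K"
            using r qs by simp
          show "\<forall>\<^sub>F t in at_top. p t \<in> ?K"
            by (rule eventually_mono[OF eventually_ge_at_top[of 0]]) (rule p(1))
        qed
        moreover have "((\<lambda>t. W (p t)) \<longlongrightarrow> c) at_top"
          by (rule tendsto_eventually, rule eventually_mono[OF eventually_ge_at_top[of 0]]) (rule Wp)
        ultimately show ?thesis
          by (intro tendsto_unique[OF trivial_limit_at_top_linorder])
      qed
      show "(q \<longlongrightarrow> qs) at_top"
        unfolding tendsto_iff
      proof (intro allI impI)
        fix e :: real assume "e > 0"
        then obtain m where m: "m > W qs" "\<And>q. q \<in> ?K \<Longrightarrow> dist q qs \<ge> e \<Longrightarrow> m \<le> W q"
          using W_gap by metis
        obtain T where T: "T \<ge> 0" "\<And>t. t \<ge> T \<Longrightarrow> W (q t) < c + (m - W qs)"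
          using W_lim[of "m - W qs"] m(1) by auto
        have "dist (q t) qs < e" if "t \<ge> T" for t
          using T(2)[OF that] m(2)[of "q t"] qK[of t] T(1) that c by force
        then show "\<forall>\<^sub>F t in at_top. dist (q t) qs < e"
          using eventually_at_top_linorder by blast
      qed
    next
      show "u n t \<in> ?K" if "t \<ge> 0" for n t
        using qK[of "real n + t"] that by (simp add: u_def)
    qed (use B mean_value compact_imp_closed[OF compact_neighbourhood]
        continuous_on_subset[OF F_continuous] in auto)
  qed
  have "equilibrium Q dyn qs"
    using qs dyn_iff[OF qs, of 0] subspace_0[OF space] F_qs by (simp add: equilibrium_def)
  then show ?thesis
    unfolding asymptotically_stable_def
    using lyapunov_stable d existence attraction by (intro conjI exI[of _ d]) auto
qed

end

section \<open>Energy balance of the lines\<close>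

lemma kronecker_mult_component:
  "((A \<otimes>\<^sub>K B) *v u) $ (i, p) = (\<Sum>k\<in>UNIV. A $ i $ k * (\<Sum>q\<in>UNIV. B $ p $ q * u $ (k, q)))"
proof -
  have "((A \<otimes>\<^sub>K B) *v u) $ (i, p) = (\<Sum>kq\<in>UNIV \<times> UNIV. A $ i $ fst kq * (B $ p $ snd kq * u $ kq))"
    by (simp add: kronecker_def matrix_vector_mult_def mult.assoc flip: UNIV_Times_UNIV)
  also have "\<dots> = (\<Sum>k\<in>UNIV. \<Sum>q\<in>UNIV. A $ i $ k * (B $ p $ q * u $ (k, q)))"
    by (subst sum.cartesian_product) (simp add: case_prod_unfold)
  finally show ?thesis
    by (simp add: sum_distrib_left)
qed

lemma pos_diagonal_sum:
  assumes "pos_diagonal_on S M"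
  shows "(\<Sum>k\<in>UNIV. M $ i $ k * a k) = M $ i $ i * a i"
proof -
  have "(\<Sum>k\<in>UNIV. M $ i $ k * a k) = (\<Sum>k\<in>{i}. M $ i $ k * a k)"
    by (rule sum.mono_neutral_right) (use assms in \<open>auto simp: pos_diagonal_on_def\<close>)
  then show ?thesis by simp
qed

lemma I2_sum: "(\<Sum>q\<in>UNIV. I2 $ p $ q * a q) = a p"
  by (simp add: I2_def mat_def if_distrib if_distribR cong: if_cong)

lemma kronecker_I2_component:
  "((A \<otimes>\<^sub>K I2) *v u) $ (i, p) = (\<Sum>k\<in>UNIV. A $ i $ k * u $ (k, p))"
  by (simp add: kronecker_mult_component I2_sum)

lemma diagonal_kronecker_component:
  assumes "pos_diagonal_on S M"
  shows "((M \<otimes>\<^sub>K B) *v u) $ (i, p) = M $ i $ i * (\<Sum>q\<in>UNIV. B $ p $ q * u $ (i, q))"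
  by (simp add: kronecker_mult_component pos_diagonal_sum[OF assms])

lemma diagonal_kronecker_I2_component:
  assumes "pos_diagonal_on S M"
  shows "((M \<otimes>\<^sub>K I2) *v u) $ (i, p) = M $ i $ i * u $ (i, p)"
  by (simp add: diagonal_kronecker_component[OF assms] I2_sum)

lemma transpose_kronecker_I2: "transpose A \<otimes>\<^sub>K I2 = transpose (A \<otimes>\<^sub>K I2)"
  by (simp add: vec_eq_iff kronecker_def transpose_def I2_def mat_def)

lemma inner_pairs: "(u :: real^('n::finite \<times> 2)) \<bullet> v = (\<Sum>i\<in>UNIV. \<Sum>p\<in>UNIV. u $ (i, p) * v $ (i, p))"
  by (simp add: inner_vec_def sum.cartesian_product case_prod_unfold flip: UNIV_Times_UNIV)

lemma inner_blocks: "u \<bullet> v = (\<Sum>j\<in>UNIV. block u j \<bullet> block v j)"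
  by (simp add: inner_pairs) (simp add: inner_vec_def block_def)

lemma diagonal_symmetric:
  assumes "pos_diagonal_on S M"
  shows "u \<bullet> ((M \<otimes>\<^sub>K I2) *v v) = v \<bullet> ((M \<otimes>\<^sub>K I2) *v u)"
  by (simp add: inner_pairs diagonal_kronecker_I2_component[OF assms] mult_ac)

text \<open>
  The rotation of the D/Q frame stores and dissipates no energy.
\<close>

lemma diagonal_kronecker_J2_skew:
  assumes "pos_diagonal_on S M"
  shows "u \<bullet> ((M \<otimes>\<^sub>K J2) *v u) = 0"
  by (simp add: inner_pairs diagonal_kronecker_component[OF assms] J2_def UNIV_2 vector_2 algebra_simps)

lemma diagonal_quadratic_form:
  assumes "pos_diagonal_on S M"
  shows "u \<bullet> ((M \<otimes>\<^sub>K I2) *v u) = (\<Sum>i\<in>UNIV. \<Sum>p\<in>UNIV. M $ i $ i * (u $ (i, p))\<^sup>2)"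
  by (simp add: inner_pairs diagonal_kronecker_I2_component[OF assms] power2_eq_square mult_ac)

lemma diagonal_nonneg: "pos_diagonal_on S M \<Longrightarrow> M $ i $ i \<ge> 0"
  by (cases "i \<in> S") (auto simp: pos_diagonal_on_def less_imp_le)

lemma quadratic_form_nonneg:
  assumes "pos_diagonal_on S M"
  shows "u \<bullet> ((M \<otimes>\<^sub>K I2) *v u) \<ge> 0"
  unfolding diagonal_quadratic_form[OF assms]
  by (intro sum_nonneg mult_nonneg_nonneg diagonal_nonneg[OF assms]) auto

lemma quadratic_form_eq_0:
  assumes M: "pos_diagonal_on S M" and supp: "\<And>i p. i \<notin> S \<Longrightarrow> u $ (i, p) = 0"
    and zero: "u \<bullet> ((M \<otimes>\<^sub>K I2) *v u) = 0"
  shows "u = 0"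
proof -
  have nonneg: "0 \<le> M $ i $ i * (u $ (i, p))\<^sup>2" for i p
    by (intro mult_nonneg_nonneg diagonal_nonneg[OF M]) auto
  have "\<forall>i p. M $ i $ i * (u $ (i, p))\<^sup>2 = 0"
    using zero unfolding diagonal_quadratic_form[OF M]
    by (simp add: sum_nonneg_eq_0_iff sum_nonneg nonneg)
  moreover have "M $ i $ i \<noteq> 0" if "i \<in> S" for i
    using M that unfolding pos_diagonal_on_def by (metis less_irrefl)
  ultimately have "u $ (i, p) = 0" for i p
    using supp[of i p] by (cases "i \<in> S") auto
  then show ?thesis
    by (simp add: vec_eq_iff)
qed

lemma line_dynamics_diff:
  assumes "line_dynamics R L G C \<omega> HB HC I V I' V' U Y"
    and "line_dynamics R L G C \<omega> HB HC I0 V0 I0' V0' U0 Y0"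
  shows "line_dynamics R L G C \<omega> HB HC (I - I0) (V - V0) (I' - I0') (V' - V0') (U - U0) (Y - Y0)"
  using assms unfolding line_dynamics_def matrix_vector_mult_diff_distrib by simp

text \<open>
  Stored power equals supplied power minus losses. The transposed incidence blocks \<open>HC\<close> exchange
  energy between inductors and capacitors without loss, and the bus block \<open>HB\<close> turns the bus voltages
  \<open>U\<close> into the power \<open>Y \<bullet> U\<close> delivered at the buses.
\<close>

lemma line_energy_balance:
  assumes dyn: "line_dynamics R L G C \<omega> HB HC I V I' V' U Y"
    and L: "pos_diagonal_on E L" and C: "pos_diagonal_on NC C"
  shows "I \<bullet> ((L \<otimes>\<^sub>K I2) *v I') + V \<bullet> ((C \<otimes>\<^sub>K I2) *v V') =
    Y \<bullet> U - I \<bullet> ((R \<otimes>\<^sub>K I2) *v I) - V \<bullet> ((G \<otimes>\<^sub>K I2) *v V)"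
proof -
  have transposed: "u \<bullet> ((transpose A \<otimes>\<^sub>K I2) *v v) = ((A \<otimes>\<^sub>K I2) *v u) \<bullet> v" for A :: "real^'m^'n" and u v
    by (simp add: transpose_kronecker_I2 inner_commute[of u] dot_lmul_matrix inner_commute[of v]
        transpose_matrix_vector)
  have "I \<bullet> ((L \<otimes>\<^sub>K I2) *v I') = - (I \<bullet> ((R \<otimes>\<^sub>K I2) *v I)) - \<omega> * (I \<bullet> ((L \<otimes>\<^sub>K J2) *v I))
      + ((HC \<otimes>\<^sub>K I2) *v I) \<bullet> V + Y \<bullet> U"
    using dyn unfolding line_dynamics_def
    by (simp add: inner_simps matrix_vector_mult_add_rdistrib scaleR_matrix_vector_assoc[symmetric] transposed)
  moreover have "V \<bullet> ((C \<otimes>\<^sub>K I2) *v V') = - (V \<bullet> ((G \<otimes>\<^sub>K I2) *v V)) - \<omega> * (V \<bullet> ((C \<otimes>\<^sub>K J2) *v V))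
      - ((HC \<otimes>\<^sub>K I2) *v I) \<bullet> V"
    using dyn unfolding line_dynamics_def
    by (simp add: inner_simps matrix_vector_mult_add_rdistrib scaleR_matrix_vector_assoc[symmetric]
        inner_commute[of V "(HC \<otimes>\<^sub>K I2) *v I"])
  ultimately show ?thesis
    using diagonal_kronecker_J2_skew[OF L] diagonal_kronecker_J2_skew[OF C] by simp
qed


section \<open>The interconnection as an explicit differential equation\<close>

text \<open>
  What the ladder structure provides: no edge ends in a padding index outside \<open>NC\<close>, so
  the capacitor equations are consistent with the zero padding.
\<close>

lemma ladder_internal_node:
  assumes net: "rlc_ladder_network E NC tail head" and "e \<in> E" and "Inr c \<in> {tail e, head e}"
  shows "c \<in> NC"
proof -
  obtain n m a b edge cap where
      edges: "bij_betw (\<lambda>(l, k). edge l k) (SIGMA l:{..<n::nat}. {1..m l}) E"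
    and caps: "bij_betw (\<lambda>(l, k). cap l k) (SIGMA l:{..<n}. {1..<m l}) NC"
    and ends: "\<forall>l<n. \<forall>k\<in>{1..m l}. {tail (edge l k), head (edge l k)} =
        {ladder_node (a l) (b l) (cap l) (m l) (k - 1), ladder_node (a l) (b l) (cap l) (m l) k}"
    using net unfolding rlc_ladder_network_def by blast
  have "e \<in> (\<lambda>(l, k). edge l k) ` (SIGMA l:{..<n}. {1..m l})"
    using edges \<open>e \<in> E\<close> by (simp add: bij_betw_def)
  then obtain l k where lk: "l < n" "k \<in> {1..m l}" "e = edge l k"
    by auto
  then have "{tail e, head e} =
      {ladder_node (a l) (b l) (cap l) (m l) (k - 1), ladder_node (a l) (b l) (cap l) (m l) k}"
    using ends by blast
  then have "Inr c \<in> {ladder_node (a l) (b l) (cap l) (m l) (k - 1), ladder_node (a l) (b l) (cap l) (m l) k}"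
    using assms(3) by simp
  then obtain i where i: "Inr c = ladder_node (a l) (b l) (cap l) (m l) i" "i \<le> m l"
    using lk(2) by auto
  then have "c = cap l i" "i \<in> {1..<m l}"
    by (auto simp: ladder_node_def split: if_splits)
  then have "c \<in> (\<lambda>(l, k). cap l k) ` (SIGMA l:{..<n}. {1..<m l})"
    using lk(1) by force
  then show ?thesis
    using caps by (simp add: bij_betw_def)
qed

definition bus_input :: "real^'e^'b::finite \<Rightarrow> real^('e::finite \<times> 2) \<Rightarrow> 'b \<Rightarrow> real^2"
  where "bus_input HB I j = - block ((HB \<otimes>\<^sub>K I2) *v I) j"

definition bus_voltages ::
    "real^'e^'b \<Rightarrow> ('b \<Rightarrow> 'x \<Rightarrow> real^2 \<Rightarrow> real^2) \<Rightarrow> real^('e::finite \<times> 2) \<Rightarrow> 'x^'b::finite \<Rightarrow> real^('b \<times> 2)"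
  where "bus_voltages HB g I x = (\<chi> r. g (fst r) (x $ fst r) (bus_input HB I (fst r)) $ snd r)"

lemma block_bus_voltages: "block (bus_voltages HB g I x) j = g j (x $ j) (bus_input HB I j)"
  by (simp add: block_def bus_voltages_def vec_eq_iff)

lemma interconnection_dynamics_iff:
  "interconnection_dynamics R L G C \<omega> HB HC f g (I, V, x) (I', V', x') \<longleftrightarrow>
    line_dynamics R L G C \<omega> HB HC I V I' V' (bus_voltages HB g I x) ((HB \<otimes>\<^sub>K I2) *v I) \<and>
    (\<forall>j. x' $ j = f j (x $ j) (bus_input HB I j))" (is "?lhs \<longleftrightarrow> ?rhs")
proof
  assume ?lhs
  then obtain U Y w z where *: "line_dynamics R L G C \<omega> HB HC I V I' V' U Y"
      "\<And>j. x' $ j = f j (x $ j) (w j) \<and> z j = g j (x $ j) (w j) \<and> w j = - block Y j \<and> block U j = z j"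
    unfolding interconnection_dynamics_def by blast
  have Y: "Y = (HB \<otimes>\<^sub>K I2) *v I"
    using *(1) by (simp add: line_dynamics_def)
  have w: "w j = bus_input HB I j" for j
    using *(2) by (simp add: bus_input_def Y)
  have "U = bus_voltages HB g I x"
  proof -
    have "block U j = block (bus_voltages HB g I x) j" for j
      using *(2)[of j] by (simp add: block_bus_voltages w)
    then have "U $ (j, p) = bus_voltages HB g I x $ (j, p)" for j p
      unfolding block_def vec_eq_iff by simp
    then show ?thesis
      by (simp add: vec_eq_iff)
  qed
  then show ?rhs
    using * Y w by simp
next
  assume ?rhs
  then show ?lhs
    unfolding interconnection_dynamics_def prod.case
    by (intro exI[of _ "bus_voltages HB g I x"] exI[of _ "(HB \<otimes>\<^sub>K I2) *v I"]
        exI[of _ "bus_input HB I"] exI[of _ "\<lambda>j. g j (x $ j) (bus_input HB I j)"])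
      (simp add: block_bus_voltages bus_input_def)
qed

text \<open>
  The dynamics solved for the derivatives. Indices outside \<open>E\<close> and \<open>NC\<close> get velocity zero since
  \<open>L\<close> and \<open>C\<close> vanish there.
\<close>

definition interconnection_field ::
    "'e set \<Rightarrow> 'c set \<Rightarrow> real^'e^'e \<Rightarrow> real^'e^'e \<Rightarrow> real^'c^'c \<Rightarrow> real^'c^'c \<Rightarrow> real \<Rightarrow>
     real^'e^'b \<Rightarrow> real^'e^'c \<Rightarrow>
     ('b \<Rightarrow> 'x \<Rightarrow> real^2 \<Rightarrow> 'x) \<Rightarrow> ('b \<Rightarrow> 'x \<Rightarrow> real^2 \<Rightarrow> real^2) \<Rightarrow>
     ('e::finite, 'c::finite, 'x, 'b::finite) network_state \<Rightarrow> ('e, 'c, 'x, 'b) network_state"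
  where "interconnection_field E NC R L G C \<omega> HB HC f g = (\<lambda>(I, V, x).
    (\<chi> r. if fst r \<in> E then
        (- ((R \<otimes>\<^sub>K I2 + \<omega> *\<^sub>R (L \<otimes>\<^sub>K J2)) *v I) + (transpose HC \<otimes>\<^sub>K I2) *v V
          + (transpose HB \<otimes>\<^sub>K I2) *v bus_voltages HB g I x) $ r / L $ fst r $ fst r else 0,
     \<chi> r. if fst r \<in> NC then
        (- ((G \<otimes>\<^sub>K I2 + \<omega> *\<^sub>R (C \<otimes>\<^sub>K J2)) *v V) - (HC \<otimes>\<^sub>K I2) *v I) $ r / C $ fst r $ fst r else 0,
     \<chi> j. f j (x $ j) (bus_input HB I j)))"

lemma continuous_on_vec_nth_pair: "continuous_on S a \<Longrightarrow> continuous_on S (\<lambda>q. a q $ r)"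
  by (intro continuous_intros)

lemma continuous_on_bus_input:
  assumes "continuous_on S a"
  shows "continuous_on S (\<lambda>q. bus_input HB (a q) j)"
  unfolding bus_input_def block_def
  by (intro continuous_intros continuous_on_vec_lambda
      bounded_linear.continuous_on[OF matrix_vector_mul_bounded_linear] assms)

lemma continuous_on_interconnection_field:
  fixes X :: "'b::finite \<Rightarrow> 'x::euclidean_space set" and HB :: "real^'e::finite^'b" and HC :: "real^'e^'c::finite"
  assumes f: "\<And>j. continuous_on (X j \<times> UNIV) (\<lambda>(x, w). f j x w)"
    and g: "\<And>j. continuous_on (X j \<times> UNIV) (\<lambda>(x, w). g j x w)"
  shows "continuous_on (interconnection_space E NC X) (interconnection_field E NC R L G C \<omega> HB HC f g)"
proof -
  let ?Q = "interconnection_space E NC X :: ('e, 'c, 'x, 'b) network_state set"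
  have feedback: "continuous_on ?Q (\<lambda>q. h j (snd (snd q) $ j) (bus_input HB (fst q) j))"
    if h: "\<And>j. continuous_on (X j \<times> UNIV) (\<lambda>(x, w). h j x w)"
    for h :: "'b \<Rightarrow> 'x \<Rightarrow> real^2 \<Rightarrow> 'y::topological_space" and j
  proof -
    have pair: "continuous_on ?Q (\<lambda>q. (snd (snd q) $ j, bus_input HB (fst q) j))"
      by (intro continuous_intros continuous_on_bus_input)
    have "continuous_on ?Q (\<lambda>q. case (snd (snd q) $ j, bus_input HB (fst q) j) of (x, w) \<Rightarrow> h j x w)"
      by (rule continuous_on_compose2[OF h pair]) (auto simp: interconnection_space_def)
    then show ?thesis by simp
  qed
  have voltages: "continuous_on ?Q (\<lambda>q. bus_voltages HB g (fst q) (snd (snd q)))"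
    unfolding bus_voltages_def
    by (intro continuous_on_vec_lambda continuous_on_vec_nth_pair feedback g)
  have linear: "continuous_on ?Q (\<lambda>q. M *v a q)" if "continuous_on ?Q a" for M :: "real^'m^'n" and a
    by (intro bounded_linear.continuous_on[OF matrix_vector_mul_bounded_linear] that)
  show ?thesis
    unfolding interconnection_field_def case_prod_unfold
  proof (intro continuous_on_Pair continuous_on_vec_lambda feedback f)
    show "continuous_on ?Q (\<lambda>q. if fst r \<in> E then
        (- ((R \<otimes>\<^sub>K I2 + \<omega> *\<^sub>R (L \<otimes>\<^sub>K J2)) *v fst q) + (transpose HC \<otimes>\<^sub>K I2) *v fst (snd q)
          + (transpose HB \<otimes>\<^sub>K I2) *v bus_voltages HB g (fst q) (snd (snd q))) $ r / L $ fst r $ fst r else 0)" for r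
      by (cases "fst r \<in> E") (simp_all add: divide_inverse, intro continuous_intros linear voltages)
    show "continuous_on ?Q (\<lambda>q. if fst r \<in> NC then
        (- ((G \<otimes>\<^sub>K I2 + \<omega> *\<^sub>R (C \<otimes>\<^sub>K J2)) *v fst (snd q)) - (HC \<otimes>\<^sub>K I2) *v fst q) $ r / C $ fst r $ fst r else 0)" for r
      by (cases "fst r \<in> NC") (simp_all add: divide_inverse, intro continuous_intros linear)
  qed
qed

text \<open>
  On padding indices both sides of the implicit equations vanish, so the derivative is fixed there
  by membership in the state space alone; on the others one divides by the positive diagonal entries.
\<close>

lemma interconnection_dynamics_explicit:
  assumes R: "pos_diagonal_on E R" and L: "pos_diagonal_on E L"
    and G: "pos_diagonal_on NC G" and C: "pos_diagonal_on NC C"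
    and HB0: "\<And>j e. e \<notin> E \<Longrightarrow> HB $ j $ e = 0"
    and HC0: "\<And>c e. e \<notin> E \<or> c \<notin> NC \<Longrightarrow> HC $ c $ e = 0"
    and q': "q' \<in> interconnection_space E NC X"
  shows "interconnection_dynamics R L G C \<omega> HB HC f g q q' \<longleftrightarrow>
    q' = interconnection_field E NC R L G C \<omega> HB HC f g q"
proof -
  obtain I V x I' V' x' where q: "q = (I, V, x)" and q'_eq: "q' = (I', V', x')"
    by (metis surj_pair)
  let ?U = "bus_voltages HB g I x"
  let ?a = "- ((R \<otimes>\<^sub>K I2 + \<omega> *\<^sub>R (L \<otimes>\<^sub>K J2)) *v I) + (transpose HC \<otimes>\<^sub>K I2) *v V
      + (transpose HB \<otimes>\<^sub>K I2) *v ?U"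
  let ?b = "- ((G \<otimes>\<^sub>K I2 + \<omega> *\<^sub>R (C \<otimes>\<^sub>K J2)) *v V) - (HC \<otimes>\<^sub>K I2) *v I"
  have off: "M $ i $ i = 0" if "pos_diagonal_on S M" "i \<notin> S" for S and M :: "real^'n^'n" and i
    using that unfolding pos_diagonal_on_def by metis
  have on: "M $ i $ i \<noteq> 0" if "pos_diagonal_on S M" "i \<in> S" for S and M :: "real^'n^'n" and i
    using that unfolding pos_diagonal_on_def by (metis less_irrefl)
  have supp: "I' $ (e, p) = 0" if "e \<notin> E" for e p
    using q' that by (simp add: interconnection_space_def q'_eq)
  have supp_V: "V' $ (c, p) = 0" if "c \<notin> NC" for c p
    using q' that by (simp add: interconnection_space_def q'_eq)
  have a0: "?a $ (e, p) = 0" if "e \<notin> E" for e p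
    using that by (simp add: matrix_vector_mult_add_rdistrib scaleR_matrix_vector_assoc[symmetric]
        diagonal_kronecker_component[OF R] diagonal_kronecker_component[OF L] off[OF R] off[OF L]
        kronecker_I2_component pos_diagonal_sum[OF R] transpose_def HB0 HC0)
  have b0: "?b $ (c, p) = 0" if "c \<notin> NC" for c p
    using that by (simp add: matrix_vector_mult_add_rdistrib scaleR_matrix_vector_assoc[symmetric]
        diagonal_kronecker_component[OF G] diagonal_kronecker_component[OF C] off[OF G] off[OF C]
        kronecker_I2_component pos_diagonal_sum[OF G] HC0)
  have solve_I: "(L \<otimes>\<^sub>K I2) *v I' = ?a \<longleftrightarrow> I' = (\<chi> r. if fst r \<in> E then ?a $ r / L $ fst r $ fst r else 0)"
  proof -
    have "L $ e $ e * I' $ (e, p) = ?a $ (e, p) \<longleftrightarrow>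
        I' $ (e, p) = (if e \<in> E then ?a $ (e, p) / L $ e $ e else 0)" for e p
    proof (cases "e \<in> E")
      case True
      then show ?thesis using on[OF L True] by (auto simp: field_simps)
    next
      case False
      then show ?thesis using a0[OF False, of p] off[OF L False] supp[OF False, of p] by simp
    qed
    then show ?thesis
      unfolding vec_eq_iff split_paired_All diagonal_kronecker_I2_component[OF L] by simp
  qed
  have solve_V: "(C \<otimes>\<^sub>K I2) *v V' = ?b \<longleftrightarrow> V' = (\<chi> r. if fst r \<in> NC then ?b $ r / C $ fst r $ fst r else 0)"
  proof -
    have "C $ c $ c * V' $ (c, p) = ?b $ (c, p) \<longleftrightarrow>
        V' $ (c, p) = (if c \<in> NC then ?b $ (c, p) / C $ c $ c else 0)" for c p
    proof (cases "c \<in> NC")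
      case True
      then show ?thesis using on[OF C True] by (auto simp: field_simps)
    next
      case False
      then show ?thesis using b0[OF False, of p] off[OF C False] supp_V[OF False, of p] by simp
    qed
    then show ?thesis
      unfolding vec_eq_iff split_paired_All diagonal_kronecker_I2_component[OF C] by simp
  qed
  have "x' = (\<chi> j. f j (x $ j) (bus_input HB I j)) \<longleftrightarrow> (\<forall>j. x' $ j = f j (x $ j) (bus_input HB I j))"
    by (simp add: vec_eq_iff)
  then show ?thesis
    unfolding q q'_eq interconnection_dynamics_iff interconnection_field_def line_dynamics_def
      prod.case prod.inject solve_I solve_V by blast
qed

lemma subspace_interconnection_space:
  assumes "\<And>j. subspace (X j)"
  shows "subspace (interconnection_space E NC X)"
  unfolding subspace_def interconnection_space_def
  using assms by (auto simp: subspace_0 subspace_add subspace_scale zero_prod_def)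

lemma interconnection_field_in_space:
  assumes "\<And>j x w. x \<in> X j \<Longrightarrow> f j x w \<in> X j" and "q \<in> interconnection_space E NC X"
  shows "interconnection_field E NC R L G C \<omega> HB HC f g q \<in> interconnection_space E NC X"
  using assms by (auto simp: interconnection_space_def interconnection_field_def case_prod_unfold)


section \<open>Storage of the buses and of the network\<close>

text \<open>
  What the network argument takes from one bus, on common neighbourhoods \<open>T\<close> of the state and \<open>N\<close> of
  the input: a differentiable storage function with a strict minimum and the passivity inequality,
  and attraction for the constant equilibrium input. The open sets are taken in the ambient space,
  which makes it easy to intersect the conditions of all buses.
\<close>

definition local_storage ::
    "'x::euclidean_space set \<Rightarrow> ('x \<Rightarrow> real^2 \<Rightarrow> 'x) \<Rightarrow> ('x \<Rightarrow> real^2 \<Rightarrow> real^2) \<Rightarrow> real^2 \<Rightarrow> 'x \<Rightarrow>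
     'x set \<Rightarrow> (real^2) set \<Rightarrow> ('x \<Rightarrow> real) \<Rightarrow> ('x \<Rightarrow> 'x) \<Rightarrow> bool"
  where "local_storage X f g ws xs T N V gradV \<longleftrightarrow>
    open T \<and> xs \<in> T \<and> open N \<and> ws \<in> N \<and>
    (\<forall>x\<in>X \<inter> T. (V has_derivative (\<lambda>h. gradV x \<bullet> h)) (at x within X)) \<and>
    (\<forall>x\<in>X \<inter> T. x \<noteq> xs \<longrightarrow> V xs < V x) \<and>
    (\<forall>x\<in>X \<inter> T. \<forall>w\<in>N. gradV x \<bullet> f x w \<le> (w - ws) \<bullet> (g x w - g xs ws)) \<and>
    (\<forall>p. solution_on X (\<lambda>x x'. x' = f x ws) {0..} p \<and> p 0 \<in> T \<longrightarrow> (p \<longlongrightarrow> xs) at_top)"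

lemma local_storage_exists:
  assumes osp: "locally_output_strictly_passive_with X f g ws xs V" and min: "strict_local_min X V xs"
    and stable: "asymptotically_stable X (\<lambda>x x'. x' = f x ws) xs"
  shows "\<exists>T N gradV. local_storage X f g ws xs T N V gradV"
proof -
  obtain N U gradV \<phi> where NU: "open N" "ws \<in> N" "openin (top_of_set X) U" "xs \<in> U"
      and grad: "has_C1_gradient_on X U V gradV" and \<phi>: "positive_definite_map \<phi>"
      and dissipation: "\<forall>w\<in>N. \<forall>x\<in>U. gradV x \<bullet> f x w \<le>
        (w - ws) \<bullet> (g x w - g xs ws) - (g x w - g xs ws) \<bullet> \<phi> (g x w - g xs ws)"
    using osp unfolding locally_output_strictly_passive_with_def by blast
  obtain U' where U': "openin (top_of_set X) U'" "xs \<in> U'" "\<forall>x\<in>U' - {xs}. V xs < V x"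
    using min unfolding strict_local_min_def by blast
  obtain d where d: "d > 0" and attract: "\<forall>q0\<in>X. dist q0 xs < d \<longrightarrow>
      (\<forall>q. solution_on X (\<lambda>x x'. x' = f x ws) {0..} q \<and> q 0 = q0 \<longrightarrow> (q \<longlongrightarrow> xs) at_top)"
    using stable unfolding asymptotically_stable_def by blast
  obtain T1 where T1: "open T1" "U = X \<inter> T1"
    using NU(3) unfolding openin_open by blast
  obtain T2 where T2: "open T2" "U' = X \<inter> T2"
    using U'(1) unfolding openin_open by blast
  have \<phi>_nonneg: "y \<bullet> \<phi> y \<ge> 0" for y
    using \<phi> by (cases "y = 0") (auto simp: positive_definite_map_def less_imp_le)
  have "local_storage X f g ws xs (T1 \<inter> T2 \<inter> ball xs d) N V gradV"
    unfolding local_storage_def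
  proof (intro conjI ballI allI impI)
    fix x assume x: "x \<in> X \<inter> (T1 \<inter> T2 \<inter> ball xs d)"
    show "(V has_derivative (\<lambda>h. gradV x \<bullet> h)) (at x within X)"
      using grad x T1 unfolding has_C1_gradient_on_def by blast
    show "V xs < V x" if "x \<noteq> xs"
      using U'(3) T2 x that by blast
    fix w assume "w \<in> N"
    then have "gradV x \<bullet> f x w \<le>
        (w - ws) \<bullet> (g x w - g xs ws) - (g x w - g xs ws) \<bullet> \<phi> (g x w - g xs ws)"
      using dissipation x T1 by blast
    then show "gradV x \<bullet> f x w \<le> (w - ws) \<bullet> (g x w - g xs ws)"
      using \<phi>_nonneg[of "g x w - g xs ws"] by linarith
  next
    fix p assume p: "solution_on X (\<lambda>x x'. x' = f x ws) {0..} p \<and> p 0 \<in> T1 \<inter> T2 \<inter> ball xs d"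
    then have "p 0 \<in> X"
      by (auto simp: solution_on_def)
    then show "(p \<longlongrightarrow> xs) at_top"
      using attract p by (auto simp: dist_commute)
  qed (use NU U' T1 T2 d in auto)
  then show ?thesis by blast
qed

lemma has_derivative_quadratic_form:
  assumes M: "pos_diagonal_on S M" and a: "(a has_derivative a') (at x within T)"
  shows "((\<lambda>x. (a x - c) \<bullet> ((M \<otimes>\<^sub>K I2) *v (a x - c)) / 2) has_derivative
    (\<lambda>h. (a x - c) \<bullet> ((M \<otimes>\<^sub>K I2) *v a' h))) (at x within T)"
proof -
  have d: "((\<lambda>x. a x - c) has_derivative a') (at x within T)"
    using a by (auto intro!: derivative_eq_intros)
  have "((\<lambda>x. (a x - c) \<bullet> ((M \<otimes>\<^sub>K I2) *v (a x - c))) has_derivative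
      (\<lambda>h. (a x - c) \<bullet> ((M \<otimes>\<^sub>K I2) *v a' h) + a' h \<bullet> ((M \<otimes>\<^sub>K I2) *v (a x - c)))) (at x within T)"
    by (intro has_derivative_inner d bounded_linear.has_derivative[OF matrix_vector_mul_bounded_linear d])
  then have "((\<lambda>x. (a x - c) \<bullet> ((M \<otimes>\<^sub>K I2) *v (a x - c)) / 2) has_derivative
      (\<lambda>h. ((a x - c) \<bullet> ((M \<otimes>\<^sub>K I2) *v a' h) + a' h \<bullet> ((M \<otimes>\<^sub>K I2) *v (a x - c))) / 2)) (at x within T)"
    by (intro bounded_linear.has_derivative[OF bounded_linear_divide])
  then show ?thesis
    by (simp only: diagonal_symmetric[OF M, of "a' _" "a x - c"] field_sum_of_halves flip: add_divide_distrib) simp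
qed

text \<open>
  Magnetic and electric energy of the deviation from the equilibrium plus the storage of the buses.
\<close>

definition network_storage ::
    "real^'e^'e \<Rightarrow> real^'c^'c \<Rightarrow> ('b \<Rightarrow> 'x \<Rightarrow> real) \<Rightarrow> real^('e \<times> 2) \<Rightarrow> real^('c \<times> 2) \<Rightarrow>
     ('e::finite, 'c::finite, 'x, 'b::finite) network_state \<Rightarrow> real"
  where "network_storage L C V INs VCs q =
    (fst q - INs) \<bullet> ((L \<otimes>\<^sub>K I2) *v (fst q - INs)) / 2 +
    (fst (snd q) - VCs) \<bullet> ((C \<otimes>\<^sub>K I2) *v (fst (snd q) - VCs)) / 2 +
    (\<Sum>j\<in>UNIV. V j (snd (snd q) $ j))"

lemma network_storage_derivative:
  fixes X :: "'b::finite \<Rightarrow> 'x::euclidean_space set"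
  assumes L: "pos_diagonal_on E L" and C: "pos_diagonal_on NC C"
    and V: "\<And>j. (V j has_derivative (\<lambda>h. gradV j \<bullet> h)) (at (snd (snd q) $ j) within X j)"
  shows "(network_storage L C V INs VCs has_derivative (\<lambda>h.
      (fst q - INs) \<bullet> ((L \<otimes>\<^sub>K I2) *v fst h) + (fst (snd q) - VCs) \<bullet> ((C \<otimes>\<^sub>K I2) *v fst (snd h)) +
      (\<Sum>j\<in>UNIV. gradV j \<bullet> (snd (snd h) $ j)))) (at q within interconnection_space E NC X)"
proof -
  let ?Q = "interconnection_space E NC X"
  have component: "bounded_linear (\<lambda>q. snd (snd q) $ j)" for j
    by (intro bounded_linear_compose[OF bounded_linear_vec_nth]
        bounded_linear_compose[OF bounded_linear_snd] bounded_linear_snd)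
  have "((\<lambda>q. V j (snd (snd q) $ j)) has_derivative (\<lambda>h. gradV j \<bullet> (snd (snd h) $ j))) (at q within ?Q)" for j
    by (rule has_derivative_in_compose[OF bounded_linear_imp_has_derivative[OF component]
          has_derivative_subset[OF V]])
      (auto simp: interconnection_space_def)
  then show ?thesis
    unfolding network_storage_def
    by (intro has_derivative_add has_derivative_sum has_derivative_quadratic_form[OF L]
        has_derivative_quadratic_form[OF C] has_derivative_fst has_derivative_snd has_derivative_ident)
qed

lemma block_diff: "block (u - v) j = block u j - block v j"
  by (simp add: block_def vec_eq_iff)

text \<open>
  The negative feedback interconnection is power preserving: the lines receive \<open>Y \<bullet> U\<close> from the buses,
  and since the bus input is the negative of the injected current, this is the negative of the sum of
  the supply rates of the buses. Only the resistive losses remain. The deviations satisfy the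
  line equations too because those are linear.
\<close>

lemma interconnection_dissipation:
  assumes L: "pos_diagonal_on E L" and C: "pos_diagonal_on NC C"
    and dyn: "interconnection_dynamics R L G C \<omega> HB HC f g (I, V, x) (I', V', x')"
    and eq: "interconnection_dynamics R L G C \<omega> HB HC f g (Is, Vs, xs) 0"
    and bus: "\<And>j. grad j \<bullet> f j (x $ j) (bus_input HB I j) \<le>
      (bus_input HB I j - bus_input HB Is j) \<bullet>
      (g j (x $ j) (bus_input HB I j) - g j (xs $ j) (bus_input HB Is j))"
  shows "(I - Is) \<bullet> ((L \<otimes>\<^sub>K I2) *v I') + (V - Vs) \<bullet> ((C \<otimes>\<^sub>K I2) *v V') + (\<Sum>j\<in>UNIV. grad j \<bullet> (x' $ j)) \<le>
    - ((I - Is) \<bullet> ((R \<otimes>\<^sub>K I2) *v (I - Is))) - (V - Vs) \<bullet> ((G \<otimes>\<^sub>K I2) *v (V - Vs))"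
proof -
  let ?Y = "(HB \<otimes>\<^sub>K I2) *v I - (HB \<otimes>\<^sub>K I2) *v Is" and ?U = "bus_voltages HB g I x - bus_voltages HB g Is xs"
  have x': "x' $ j = f j (x $ j) (bus_input HB I j)" for j
    using dyn by (simp add: interconnection_dynamics_iff)
  have "line_dynamics R L G C \<omega> HB HC (I - Is) (V - Vs) (I' - 0) (V' - 0) ?U ?Y"
    using dyn eq unfolding zero_prod_def interconnection_dynamics_iff by (intro line_dynamics_diff) auto
  from line_energy_balance[OF this L C]
  have energy: "(I - Is) \<bullet> ((L \<otimes>\<^sub>K I2) *v I') + (V - Vs) \<bullet> ((C \<otimes>\<^sub>K I2) *v V') =
      ?Y \<bullet> ?U - (I - Is) \<bullet> ((R \<otimes>\<^sub>K I2) *v (I - Is)) - (V - Vs) \<bullet> ((G \<otimes>\<^sub>K I2) *v (V - Vs))"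
    by simp
  have "?Y \<bullet> ?U = - (\<Sum>j\<in>UNIV. (bus_input HB I j - bus_input HB Is j) \<bullet>
      (g j (x $ j) (bus_input HB I j) - g j (xs $ j) (bus_input HB Is j)))"
    unfolding inner_blocks[of ?Y] block_diff block_bus_voltages sum_negf[symmetric]
    by (rule sum.cong) (simp_all add: bus_input_def inner_simps)
  moreover have "(\<Sum>j\<in>UNIV. grad j \<bullet> (x' $ j)) \<le> (\<Sum>j\<in>UNIV. (bus_input HB I j - bus_input HB Is j) \<bullet>
      (g j (x $ j) (bus_input HB I j) - g j (xs $ j) (bus_input HB Is j)))"
    unfolding x' by (rule sum_mono) (rule bus)
  ultimately show ?thesis
    using energy by linarith
qed

lemma network_storage_strict_min:
  assumes L: "pos_diagonal_on E L" and C: "pos_diagonal_on NC C"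
    and space: "(I, V, x) \<in> interconnection_space E NC X" "(Is, Vs, xs) \<in> interconnection_space E NC X"
    and bus: "\<And>j. x $ j \<noteq> xs $ j \<Longrightarrow> S j (xs $ j) < S j (x $ j)"
    and neq: "(I, V, x) \<noteq> (Is, Vs, xs)"
  shows "network_storage L C S Is Vs (Is, Vs, xs) < network_storage L C S Is Vs (I, V, x)"
proof -
  have S_le: "S j (xs $ j) \<le> S j (x $ j)" for j
    using bus[of j] by (cases "x $ j = xs $ j") auto
  have sum_le: "(\<Sum>j\<in>UNIV. S j (xs $ j)) \<le> (\<Sum>j\<in>UNIV. S j (x $ j))"
    by (intro sum_mono S_le)
  note nonneg = quadratic_form_nonneg[OF L, of "I - Is"] quadratic_form_nonneg[OF C, of "V - Vs"]
  have "I - Is = 0" if "(I - Is) \<bullet> ((L \<otimes>\<^sub>K I2) *v (I - Is)) = 0"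
    using quadratic_form_eq_0[OF L _ that] space by (auto simp: interconnection_space_def)
  moreover have "V - Vs = 0" if "(V - Vs) \<bullet> ((C \<otimes>\<^sub>K I2) *v (V - Vs)) = 0"
    using quadratic_form_eq_0[OF C _ that] space by (auto simp: interconnection_space_def)
  moreover have "(\<Sum>j\<in>UNIV. S j (xs $ j)) < (\<Sum>j\<in>UNIV. S j (x $ j))" if x_neq: "x \<noteq> xs"
  proof -
    obtain j where "x $ j \<noteq> xs $ j"
      using x_neq by (auto simp: vec_eq_iff)
    then show ?thesis
      using S_le bus by (intro sum_strict_mono_ex1) auto
  qed
  ultimately have "(I - Is) \<bullet> ((L \<otimes>\<^sub>K I2) *v (I - Is)) > 0 \<or> (V - Vs) \<bullet> ((C \<otimes>\<^sub>K I2) *v (V - Vs)) > 0 \<or>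
      (\<Sum>j\<in>UNIV. S j (xs $ j)) < (\<Sum>j\<in>UNIV. S j (x $ j))"
    using neq nonneg by (auto simp: less_le)
  then show ?thesis
    using nonneg sum_le unfolding network_storage_def by auto
qed

lemma open_bus_input_vimage:
  assumes "open N"
  shows "open {I. bus_input HB I j \<in> N}"
proof -
  have "continuous_on UNIV (\<lambda>I. bus_input HB I j)"
    by (intro continuous_on_bus_input continuous_on_id)
  then show ?thesis
    using open_vimage[OF assms] by (simp add: vimage_def)
qed


section \<open>Asymptotic stability of the interconnection\<close>

theorem theorem1:
  fixes E :: "'e::finite set" and NC :: "'c::finite set"
    and tail head :: "'e \<Rightarrow> 'b::finite + 'c"
    and R L :: "real^'e^'e" and G C :: "real^'c^'c" and \<omega>s :: real
    and H :: "real^'e^('b + 'c)" and HB :: "real^'e^'b" and HC :: "real^'e^'c"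
    and X :: "'b \<Rightarrow> 'x::euclidean_space set"
    and f :: "'b \<Rightarrow> 'x \<Rightarrow> real^2 \<Rightarrow> 'x" and g :: "'b \<Rightarrow> 'x \<Rightarrow> real^2 \<Rightarrow> real^2"
    and INs :: "real^('e \<times> 2)" and VCs :: "real^('c \<times> 2)" and xs :: "'x^'b"
    and ws :: "'b \<Rightarrow> real^2"
  assumes network: "rlc_ladder_network E NC tail head"
    and H_def: "H = incidence E tail head" "HB = bus_rows H" "HC = cap_rows H"
    and diagonal: "pos_diagonal_on E R" "pos_diagonal_on E L"
      "pos_diagonal_on NC G" "pos_diagonal_on NC C"
    and state_space: "\<And>j. subspace (X j)"
    and f_maps: "\<And>j x w. x \<in> X j \<Longrightarrow> f j x w \<in> X j"
    and f_lipschitz: "\<And>j. local_lipschitz (UNIV :: real set) (X j \<times> UNIV) (\<lambda>t (x, w). f j x w)"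
    and g_continuous: "\<And>j. continuous_on (X j \<times> UNIV) (\<lambda>(x, w). g j x w)"
    and equilibrium: "equilibrium (interconnection_space E NC X)
      (interconnection_dynamics R L G C \<omega>s HB HC f g) (INs, VCs, xs)"
    and ws_def: "\<And>j. ws j = - block ((HB \<otimes>\<^sub>K I2) *v INs) j"
    and passivity: "\<And>j. \<exists>V. locally_output_strictly_passive_with (X j) (f j) (g j) (ws j) (xs $ j) V \<and>
      locally_continuous (X j) V (xs $ j) \<and> strict_local_min (X j) V (xs $ j)"
    and bus_stable: "\<And>j. asymptotically_stable (X j) (\<lambda>x x'. x' = f j x (ws j)) (xs $ j)"
  shows "asymptotically_stable (interconnection_space E NC X)
    (interconnection_dynamics R L G C \<omega>s HB HC f g) (INs, VCs, xs)"
proof -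
  let ?Q = "interconnection_space E NC X"
  let ?dyn = "interconnection_dynamics R L G C \<omega>s HB HC f g"
  let ?F = "interconnection_field E NC R L G C \<omega>s HB HC f g"
  let ?qs = "(INs, VCs, xs)"
  have ws: "ws j = bus_input HB INs j" for j
    by (simp add: ws_def bus_input_def)
  have HB0: "HB $ j $ e = 0" if "e \<notin> E" for j e
    using that by (simp add: H_def bus_rows_def incidence_def)
  have HC0: "HC $ c $ e = 0" if "e \<notin> E \<or> c \<notin> NC" for c e
    using that ladder_internal_node[OF network, of e c] by (auto simp: H_def cap_rows_def incidence_def)
  have space: "subspace ?Q"
    by (rule subspace_interconnection_space[OF state_space])
  have qs: "?qs \<in> ?Q" and dyn_qs: "?dyn ?qs 0"
    using equilibrium by (simp_all add: equilibrium_def)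
  have dyn_iff: "?dyn q q' \<longleftrightarrow> q' = ?F q" if "q' \<in> ?Q" for q q'
    by (rule interconnection_dynamics_explicit[OF diagonal HB0 HC0 that])
  have F_maps: "?F q \<in> ?Q" if "q \<in> ?Q" for q
    by (rule interconnection_field_in_space[OF f_maps that])
  have "\<forall>j. \<exists>V T N gradV. local_storage (X j) (f j) (g j) (ws j) (xs $ j) T N V gradV"
  proof
    fix j
    obtain V where "locally_output_strictly_passive_with (X j) (f j) (g j) (ws j) (xs $ j) V"
        "strict_local_min (X j) V (xs $ j)"
      using passivity[of j] by blast
    then show "\<exists>V T N gradV. local_storage (X j) (f j) (g j) (ws j) (xs $ j) T N V gradV"
      using local_storage_exists[of "X j" "f j" "g j" "ws j" "xs $ j" V] bus_stable[of j] by blast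
  qed
  then obtain V T N gradV where
    st: "\<And>j. local_storage (X j) (f j) (g j) (ws j) (xs $ j) (T j) (N j) (V j) (gradV j)"
    by metis
  obtain r where r: "r > 0"
    and near: "\<And>q j. q \<in> cball ?qs r \<Longrightarrow> snd (snd q) $ j \<in> T j \<and> bus_input HB (fst q) j \<in> N j"
  proof -
    let ?O = "\<Inter>j. {I. bus_input HB I j \<in> N j} \<times> (UNIV \<times> {x. x $ j \<in> T j})"
    have TN: "open (T j)" "xs $ j \<in> T j" "open (N j)" "bus_input HB INs j \<in> N j" for j
      using st[of j] unfolding local_storage_def ws by blast+
    have "open {x. x $ j \<in> T j}" for j
      using open_vimage_vec_nth[OF TN(1), of j j] by (simp add: vimage_def)
    then have "open ?O"
      by (intro open_INT finite ballI open_Times open_bus_input_vimage open_UNIV TN)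
    moreover have "?qs \<in> ?O"
      using TN by simp
    ultimately have "\<exists>r>0. cball ?qs r \<subseteq> ?O"
      by (rule open_contains_cball[THEN iffD1, rule_format])
    then obtain r where r: "r > 0" "cball ?qs r \<subseteq> ?O"
      by (elim exE conjE)
    show ?thesis
    proof (rule that[OF r(1)])
      fix q j assume "q \<in> cball ?qs r"
      then have "q \<in> ?O"
        by (rule subsetD[OF r(2)])
      then show "snd (snd q) $ j \<in> T j \<and> bus_input HB (fst q) j \<in> N j"
        by (simp add: mem_Times_iff)
    qed
  qed
  define W where "W = network_storage L C V INs VCs"
  define Z where "Z = {q :: ('e, 'c, 'x, 'b) network_state. fst q = INs \<and> fst (snd q) = VCs}"
  have "lasalle_system ?Q ?dyn ?F W Z ?qs r"
  proof
    show "?F ?qs = 0"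
      using dyn_iff[OF subspace_0[OF space]] dyn_qs by simp
    show "continuous_on ?Q ?F"
      using f_lipschitz by (intro continuous_on_interconnection_field g_continuous local_lipschitz_continuous_on[of UNIV _ _ 0]) auto
  next
    fix q assume q: "q \<in> ?Q \<inter> cball ?qs r"
    obtain I U x where q_eq: "q = (I, U, x)"
      by (metis surj_pair)
    obtain I' U' x' where F_eq: "?F q = (I', U', x')"
      by (metis surj_pair)
    have x: "x $ j \<in> X j \<inter> T j" and w: "bus_input HB I j \<in> N j" for j
      using q near[of q j] by (auto simp: q_eq interconnection_space_def)
    have V_deriv: "(V j has_derivative (\<lambda>h. gradV j (x $ j) \<bullet> h)) (at (x $ j) within X j)" for j
      using st[of j] x[of j] unfolding local_storage_def by blast
    \<comment> \<open>The derivative of the network storage at \<open>q\<close>.\<close>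
    define W' where "W' h = (I - INs) \<bullet> ((L \<otimes>\<^sub>K I2) *v fst h) + (U - VCs) \<bullet> ((C \<otimes>\<^sub>K I2) *v fst (snd h)) +
      (\<Sum>j\<in>UNIV. gradV j (x $ j) \<bullet> (snd (snd h) $ j))" for h :: "('e, 'c, 'x, 'b) network_state"
    have deriv: "(W has_derivative W') (at q within ?Q)"
      using network_storage_derivative[OF diagonal(2,4), of V "\<lambda>j. gradV j (x $ j)" q X INs VCs] V_deriv
      unfolding W_def W'_def q_eq by simp
    have dissipation: "W' (?F q) \<le> - ((I - INs) \<bullet> ((R \<otimes>\<^sub>K I2) *v (I - INs)))
        - (U - VCs) \<bullet> ((G \<otimes>\<^sub>K I2) *v (U - VCs))"
    proof -
      have "?dyn (I, U, x) (I', U', x')"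
        using dyn_iff[OF F_maps, of q q] q by (simp add: q_eq F_eq[unfolded q_eq])
      moreover have "gradV j (x $ j) \<bullet> f j (x $ j) (bus_input HB I j) \<le>
          (bus_input HB I j - bus_input HB INs j) \<bullet>
          (g j (x $ j) (bus_input HB I j) - g j (xs $ j) (bus_input HB INs j))" for j
        using st[of j] x[of j] w[of j] unfolding local_storage_def ws by blast
      ultimately show ?thesis
        using interconnection_dissipation[OF diagonal(2,4) _ dyn_qs, of I U x I' U' x' "\<lambda>j. gradV j (x $ j)"]
        unfolding W'_def F_eq by simp
    qed
    note nonneg = quadratic_form_nonneg[OF diagonal(1), of "I - INs"] quadratic_form_nonneg[OF diagonal(3), of "U - VCs"]
    have "q \<in> Z" if "W' (?F q) = 0"
    proof -
      have "I - INs = 0"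
        by (rule quadratic_form_eq_0[OF diagonal(1)])
          (use dissipation nonneg that q qs in \<open>auto simp: q_eq interconnection_space_def\<close>)
      moreover have "U - VCs = 0"
        by (rule quadratic_form_eq_0[OF diagonal(3)])
          (use dissipation nonneg that q qs in \<open>auto simp: q_eq interconnection_space_def\<close>)
      ultimately show ?thesis
        by (simp add: Z_def q_eq)
    qed
    then show "\<exists>W'. (W has_derivative W') (at q within ?Q) \<and> W' (?F q) \<le> 0 \<and> (W' (?F q) = 0 \<longrightarrow> q \<in> Z)"
      using deriv dissipation nonneg by (intro exI[of _ W']) auto
    show "W ?qs < W q" if "q \<noteq> ?qs"
    proof -
      have "V j (xs $ j) < V j (x $ j)" if "x $ j \<noteq> xs $ j" for j
        using st[of j] x[of j] that unfolding local_storage_def by blast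
      then show ?thesis
        unfolding W_def q_eq
        using q qs that by (intro network_storage_strict_min[OF diagonal(2,4)]) (auto simp: q_eq)
    qed
  next
    fix p assume sol: "solution_on ?Q ?dyn {0..} p" and pZ: "\<And>t. t \<ge> 0 \<Longrightarrow> p t \<in> Z \<inter> cball ?qs r"
    \<comment> \<open>With the line currents at their equilibrium values the bus inputs are constant, so the buses
      decouple and each converges by its own asymptotic stability.\<close>
    let ?x = "\<lambda>j t. snd (snd (p t)) $ j"
    have bus: "solution_on (X j) (\<lambda>x x'. x' = f j x (ws j)) {0..} (?x j)" for j
      unfolding solution_on_def
    proof (intro ballI conjI)
      fix t :: real assume t: "t \<in> {0..}"
      then obtain q' where q': "p t \<in> ?Q" "(p has_vector_derivative q') (at t within {0..})" "?dyn (p t) q'"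
        using sol unfolding solution_on_def by blast
      show "?x j t \<in> X j"
        using q'(1) by (auto simp: interconnection_space_def)
      have "((\<lambda>t. ?x j t) has_vector_derivative snd (snd q') $ j) (at t within {0..})"
        by (intro bounded_linear.has_vector_derivative[OF bounded_linear_vec_nth]
            bounded_linear.has_vector_derivative[OF bounded_linear_snd] q'(2))
      moreover have "snd (snd q') $ j = f j (?x j t) (ws j)"
      proof -
        have "fst (p t) = INs"
          using pZ[of t] t by (simp add: Z_def)
        moreover have "?dyn (fst (p t), fst (snd (p t)), snd (snd (p t))) (fst q', fst (snd q'), snd (snd q'))"
          using q'(3) by simp
        ultimately show ?thesis
          unfolding interconnection_dynamics_iff ws by simp
      qed
      ultimately show "\<exists>x'. (?x j has_vector_derivative x') (at t within {0..}) \<and> x' = f j (?x j t) (ws j)"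
        by blast
    qed
    have "(?x j \<longlongrightarrow> xs $ j) at_top" for j
      using st[of j] bus[of j] near[of "p 0" j] pZ[of 0] unfolding local_storage_def by blast
    then have "((\<lambda>t. snd (snd (p t))) \<longlongrightarrow> xs) at_top"
      by (rule vec_tendstoI)
    then have "((\<lambda>t. (INs, VCs, snd (snd (p t)))) \<longlongrightarrow> ?qs) at_top"
      by (intro tendsto_Pair tendsto_const)
    moreover have "\<forall>\<^sub>F t in at_top. (INs, VCs, snd (snd (p t))) = p t"
      by (rule eventually_mono[OF eventually_ge_at_top[of 0]]) (use pZ in \<open>auto simp: Z_def prod_eq_iff\<close>)
    ultimately show "(p \<longlongrightarrow> ?qs) at_top"
      by (rule Lim_transform_eventually)
  qed (use space qs r dyn_iff F_maps in auto)
  then show ?thesis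
    by (rule lasalle_system.asymptotically_stable)
qed

end
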